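(* Let $n>1$. Let Assumption P (stated in the context) hold and suppose that all agents have the same initial wealth $w^i=w/n>0$ and the same utility function $u^i\equiv u$ satisfying Assumption U (stated in the context), with $u_{xc}\ge0$. Let $(x^i_*,C^i_* )\equiv(\frac1nx_*,\frac1nC_* )$, $i=1,\dots,n$, be the symmetric solution of the social planner problem with weights $\gamma^i=1/n$, and let $(\hat x^i,\hat C^i)\equiv(\frac1n\hat x,\frac1n\hat C)$, $i=1,\dots,n$, be the symmetric Nash equilibrium of the public good contribution game. If $E[C_*(T)]>0$, then $$E\Big[\int_0^T\psi_c(t)\big(dC_*(t)-d\hat C(t)\big)\Big]>0;$$ that is, the total expenditure for the public good is higher for the social planner.
   Context: Setting. Fix $0<T\le\infty$, a number $n$ of agents, and a filtered probability space $(\Omega,\mathcal{F},\{\mathcal{F}_t\}_{t\in[0,T]},P)$ satisfying the usual conditions, with expectation $E$. Let $w^i>0$ be initial wealths, $\psi_x,\psi_c$ strictly positive price processes, $r$ a discount rate process. For nonnegative processes set $$\Psi(x^i,C^i):=E\Big[\int_0^T\psi_x(t)x^i(t)\,dt+\int_0^T\psi_c(t)\,dC^i(t)\Big].$$ For a nondecreasing right-continuous $C$, $\int_0^T(\cdot)\,dC(t)$ denotes the Lebesgue–Stieltjes integral over $[0,T]$, including a possible point mass $C(0)$ at $t=0$ (convention $C(0-)=0$). The budget sets are $$\mathcal{B}_{w^i}:=\{(x^i,C^i):\Omega\times[0,T]\to\mathbb{R}_+^2\text{ optional}:\ C^i\text{ right-continuous, nondecreasing},\ C^i(0-)=0\ P\text{-a.s.},\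 \Psi(x^i,C^i)\le w^i\}.$$ Payoffs: with $C:=\sum_{j}C^j$, $C^{-i}:=\sum_{j\ne i}C^j$ and $u^i:\mathbb{R}_+^2\to\mathbb{R}_+$, $$U^i(x^i,C^i;C^{-i}):=E\Big[\int_0^T e^{-\int_0^t r(s)ds}u^i(x^i(t),C(t))\,dt\Big].$$ Subscripts on $u$ denote partial derivatives. Social planner. $w=\sum_i w^i$; $(\underline{x},\underline{C})=(x^1,\dots,x^n,C^1,\dots,C^n)$; $$\mathcal{B}_w:=\{(\underline{x},\underline{C}):\Omega\times[0,T]\to\mathbb{R}_+^{2n}\text{ optional}:\ C^i\text{ right-continuous, nondecreasing},\ C^i(0-)=0\ P\text{-a.s. for all }i,\ \sum_{i=1}^n\Psi(x^i,C^i)\le w\}.$$ The social planner problem with weights $\gamma^i$ is $\sup_{(\underline{x},\underline{C})\in\mathcal{B}_w}\sum_{i=1}^n\gamma^iU^i(x^i,C^i;C^{-i})$. Public good contribution game. Let $V^i(C^{-i}):=\sup_{(x^i,C^i)\in\mathcal{B}_{w^i}}U^i(x^i,C^i;C^{-i})$. A tuple $(\hat x^1,\dots,\hat x^n,\hat C^1,\dots,\hat C^n)$ is a Nash equilibrium if for all $i$, $(\hat x^i,\hat C^i)\in\mathcal{B}_{w^i}$ and $U^i(\hat x^i,\hat C^i;\hat C^{-i})=V^i(\hat C^{-i})$; it is symmetric if $(\hat x^i,\hat C^i)=(\hat x^1,\hat C^1)$ for all $i$. Assumption U. (i) Each $u^i$ is increasing and strictly concave on $\mathbb{R}_+^2$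 and twice continuously differentiable on $\mathbb{R}_{++}^2$ with negative definite Hessian; moreover $\lim_{x\downarrow0}u^i_x(x,c)=+\infty$ and $\lim_{x\uparrow\infty}u^i_x(x,c)=0$ for any $c>0$. (ii) For each $i$ the family $e^{-\int_0^t r(\omega,s)ds}u^i(x^i(\omega,t),C(\omega,t))$, indexed by $((x^j,C^j))_{j}\in\prod_{j=1}^n\mathcal{B}_{w^j}$ with $C=\sum_jC^j$, is $P\otimes dt$-uniformly integrable. Assumption P. (i) $\psi_c=\{\psi_c(t),t\in[0,T]\}$ is adapted, right-continuous, $\psi_c(t)=e^{-\int_0^t r_c(s)ds}\mathcal{E}_c(t)$ a.s. for every $t\in[0,T]$, with $r_c$ a uniformly bounded, strictly positive process and $\mathcal{E}_c=\{\mathcal{E}_c(t),t\in[0,T]\}$ an exponential martingale (strictly positive, mean one); if $T=\infty$ then $\psi_c(T)=0$ a.s. (ii) $\psi_x$ is adapted, right-continuous, $\psi_x(t)=e^{-\int_0^t r_x(s)ds}\mathcal{E}_x(t)$ a.s. for every $t\in[0,T]$, with $r_x$ uniformly bounded and strictly positive and $\mathcal{E}_x$ an exponential martingale. (iii) $r$ is optional, strictly positive and uniformly bounded.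
   Formalization: For T=∞, the hypothesis E[C_*(T)]>0 is taken with C_*(T) meaning the limit of C_*(t) as t→∞: as ψ_c(∞)=0, a jump of C_* at time ∞ is free and affects no payoff, so with such jumps counted the claim would fail when C_*=0 on [0,∞). *)

theory Defs
  imports "HOL-Probability.Probability"
begin

text \<open>
  Time is \<^typ>\<open>ereal\<close>, so that the horizon \<open>T\<close> may be \<open>\<infinity>\<close> and \<open>{0..T}\<close> is the closed interval
  \<open>[0,T]\<close>, with the point \<open>\<infinity>\<close> if \<open>T = \<infinity>\<close>. Values of a process or of the filtration at times
  outside \<open>{0..T}\<close> are never used, apart from the monotonicity that the library locale
  \<^locale>\<open>filtration\<close> asks for on the whole index type (a filtration on \<open>[0,T]\<close> can be continued
  by constants).
\<close>

type_synonym 'a process = "ereal \<Rightarrow> 'a \<Rightarrow> real"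

section \<open>Filtered probability spaces and processes\<close>

locale usual_filtered_prob_space = prob_space M + complete_measure M + filtration "space M" F
  for M :: "'a measure" and F :: "ereal \<Rightarrow> 'a measure" and T :: ereal +
  assumes horizon_pos: "0 < T"
    and subalgebra_F: "\<And>t. t \<in> {0..T} \<Longrightarrow> subalgebra M (F t)"
    and null_sets_F: "null_sets M \<subseteq> sets (F 0)"
    and right_continuous_F: "\<And>t. t \<in> {0..<T} \<Longrightarrow> sets (F t) = (\<Inter>s\<in>{t<..T}. sets (F s))"

definition finite_times :: "ereal \<Rightarrow> ereal set" where
  "finite_times T = {t \<in> {0..T}. t < \<infinity>}"

text \<open>The measure \<open>dt\<close> on \<open>[0,T]\<close>, carried by the real points of that interval.\<close>

definition dt :: "ereal \<Rightarrow> real measure" where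
  "dt T = restrict_space lborel {s. 0 \<le> s \<and> ereal s \<le> T}"

definition adapted :: "(ereal \<Rightarrow> 'a measure) \<Rightarrow> ereal \<Rightarrow> 'a process \<Rightarrow> bool" where
  "adapted F T X \<longleftrightarrow> (\<forall>t\<in>{0..T}. X t \<in> borel_measurable (F t))"

definition right_continuous_path :: "ereal \<Rightarrow> (ereal \<Rightarrow> real) \<Rightarrow> bool" where
  "right_continuous_path T f \<longleftrightarrow> (\<forall>t\<in>{0..<T}. (f \<longlongrightarrow> f t) (at_right t))"

definition cadlag_path :: "ereal \<Rightarrow> (ereal \<Rightarrow> real) \<Rightarrow> bool" where
  "cadlag_path T f \<longleftrightarrow> right_continuous_path T f \<and> (\<forall>t\<in>{0<..T}. \<exists>l. (f \<longlongrightarrow> l) (at_left t))"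

text \<open>The optional \<open>\<sigma>\<close>-algebra on \<open>\<Omega> \<times> [0,T]\<close> is generated by the adapted cadlag processes.\<close>

definition optional_algebra ::
    "'a measure \<Rightarrow> (ereal \<Rightarrow> 'a measure) \<Rightarrow> ereal \<Rightarrow> ('a \<times> ereal) measure" where
  "optional_algebra M F T = sigma (space M \<times> {0..T})
     {(\<lambda>(\<omega>, t). X t \<omega>) -` B \<inter> (space M \<times> {0..T}) | X B.
        adapted F T X \<and> (\<forall>\<omega>\<in>space M. cadlag_path T (\<lambda>t. X t \<omega>)) \<and> B \<in> sets (borel :: real measure)}"

definition optional_process ::
    "'a measure \<Rightarrow> (ereal \<Rightarrow> 'a measure) \<Rightarrow> ereal \<Rightarrow> 'a process \<Rightarrow> bool" where
  "optional_process M F T X \<longleftrightarrow> (\<lambda>(\<omega>, t). X t \<omega>) \<in> borel_measurable (optional_algebra M F T)"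

definition martingale_on ::
    "'a measure \<Rightarrow> (ereal \<Rightarrow> 'a measure) \<Rightarrow> ereal set \<Rightarrow> 'a process \<Rightarrow> bool" where
  "martingale_on M F I X \<longleftrightarrow>
     (\<forall>t\<in>I. X t \<in> borel_measurable (F t) \<and> integrable M (X t)) \<and>
     (\<forall>s\<in>I. \<forall>t\<in>I. s \<le> t \<longrightarrow> (AE \<omega> in M. real_cond_exp M (F s) (X t) \<omega> = X s \<omega>))"

text \<open>If \<open>T = \<infinity>\<close>, the martingale property, positivity and mean one are asked for on \<open>[0,\<infinity>)\<close> only; being a
  martingale on \<open>[0,\<infinity>]\<close> would mean uniform integrability and exclude geometric Brownian motion.\<close>

definition exponential_martingale ::
    "'a measure \<Rightarrow> (ereal \<Rightarrow> 'a measure) \<Rightarrow> ereal \<Rightarrow> 'a process \<Rightarrow> bool" where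
  "exponential_martingale M F T X \<longleftrightarrow>
     martingale_on M F (finite_times T) X \<and>
     (\<forall>t\<in>finite_times T. (\<forall>\<omega>\<in>space M. 0 < X t \<omega>) \<and> (LINT \<omega>|M. X t \<omega>) = 1)"

definition bounded_positive :: "'a measure \<Rightarrow> ereal \<Rightarrow> 'a process \<Rightarrow> bool" where
  "bounded_positive M T X \<longleftrightarrow> (\<exists>K. \<forall>t\<in>{0..T}. \<forall>\<omega>\<in>space M. 0 < X t \<omega> \<and> X t \<omega> \<le> K)"

definition discount :: "'a process \<Rightarrow> real \<Rightarrow> 'a \<Rightarrow> real" where
  "discount r s \<omega> = exp (- (LINT v:{0..s}|lborel. r (ereal v) \<omega>))"

text \<open>
  Uniform integrability over a possibly infinite measure (\<open>P \<otimes> dt\<close> if \<open>T = \<infinity>\<close>): the cut-off is an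
  integrable function instead of a constant. Over a finite measure this is equivalent to the
  definition with constant cut-offs; over an infinite one constant cut-offs would not even bound
  the integrals.
\<close>

definition uniformly_integrable :: "'b measure \<Rightarrow> ('b \<Rightarrow> real) set \<Rightarrow> bool" where
  "uniformly_integrable N \<F> \<longleftrightarrow> \<F> \<subseteq> borel_measurable N \<and>
     (\<forall>\<epsilon>>0. \<exists>g. integrable N g \<and> (\<forall>z\<in>space N. 0 \<le> g z) \<and>
        (\<forall>f\<in>\<F>. (\<integral>\<^sup>+z\<in>{z\<in>space N. g z < \<bar>f z\<bar>}. ennreal \<bar>f z\<bar> \<partial>N) \<le> ennreal \<epsilon>))"


section \<open>Expenditure and budgets\<close>

text \<open>
  The value \<open>C(T)\<close> of a nondecreasing path, where \<open>C(\<infinity>)\<close> is understood as the limit of \<open>C(t)\<close>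
  for \<open>t \<rightarrow> \<infinity>\<close>. The limit convention matters only if \<open>T = \<infinity>\<close>: since \<open>\<psi>\<^sub>c(\<infinity>) = 0\<close>, a jump at
  \<open>\<infinity>\<close> is free and affects no payoff, so it can be added to any solution. Budget sets do allow such
  jumps.
\<close>

definition terminal_value :: "ereal \<Rightarrow> (ereal \<Rightarrow> real) \<Rightarrow> ennreal" where
  "terminal_value T C = (if T < \<infinity> then ennreal (C T) else (SUP t\<in>{0..<\<infinity>}. ennreal (C t)))"

text \<open>
  The Lebesgue-Stieltjes integral over \<open>[0,T]\<close> of a nonnegative \<open>f\<close> against a nondecreasing
  right-continuous \<open>C \<ge> 0\<close>. Continuing \<open>C\<close> by \<open>0\<close> to negative times is the convention
  \<open>C(0-) = 0\<close>: it gives the point \<open>0\<close> the mass \<open>C(0)\<close>. The second summand is the contribution of the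
  point \<open>\<infinity>\<close>, whose mass is \<open>C(\<infinity>) - C(\<infinity>-)\<close>.
\<close>

definition stieltjes_integral :: "ereal \<Rightarrow> (ereal \<Rightarrow> real) \<Rightarrow> (ereal \<Rightarrow> real) \<Rightarrow> ennreal" where
  "stieltjes_integral T f C =
     (\<integral>\<^sup>+s\<in>{s. 0 \<le> s \<and> ereal s \<le> T}. ennreal (f (ereal s))
        \<partial>interval_measure (\<lambda>s. if s < 0 then 0 else C (min (ereal s) T))) +
     (if T = \<infinity> then ennreal (f \<infinity>) * (ennreal (C \<infinity>) - (SUP t\<in>{0..<\<infinity>}. ennreal (C t))) else 0)"

definition expenditure ::
    "'a measure \<Rightarrow> ereal \<Rightarrow> 'a process \<Rightarrow> 'a process \<Rightarrow> 'a process \<Rightarrow> 'a process \<Rightarrow> ennreal" where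
  "expenditure M T \<psi>x \<psi>c x C =
     (\<integral>\<^sup>+\<omega>. ((\<integral>\<^sup>+s. ennreal (\<psi>x (ereal s) \<omega> * x (ereal s) \<omega>) \<partial>dt T)
            + stieltjes_integral T (\<lambda>t. \<psi>c t \<omega>) (\<lambda>t. C t \<omega>)) \<partial>M)"

definition admissible ::
    "'a measure \<Rightarrow> (ereal \<Rightarrow> 'a measure) \<Rightarrow> ereal \<Rightarrow> 'a process \<Rightarrow> 'a process \<Rightarrow> bool" where
  "admissible M F T x C \<longleftrightarrow>
     optional_process M F T x \<and> optional_process M F T C \<and>
     (\<forall>t\<in>{0..T}. \<forall>\<omega>\<in>space M. 0 \<le> x t \<omega> \<and> 0 \<le> C t \<omega>) \<and>
     (AE \<omega> in M. right_continuous_path T (\<lambda>t. C t \<omega>) \<and> mono_on {0..T} (\<lambda>t. C t \<omega>))"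

definition budget_set ::
    "'a measure \<Rightarrow> (ereal \<Rightarrow> 'a measure) \<Rightarrow> ereal \<Rightarrow> 'a process \<Rightarrow> 'a process \<Rightarrow> real
     \<Rightarrow> ('a process \<times> 'a process) set" where
  "budget_set M F T \<psi>x \<psi>c w =
     {(x, C). admissible M F T x C \<and> expenditure M T \<psi>x \<psi>c x C \<le> ennreal w}"

text \<open>The agents are \<open>1, \<dots>, n\<close>; values of tuples at other indices are irrelevant.\<close>

definition planner_budget_set ::
    "'a measure \<Rightarrow> (ereal \<Rightarrow> 'a measure) \<Rightarrow> ereal \<Rightarrow> 'a process \<Rightarrow> 'a process \<Rightarrow> nat \<Rightarrow> real
     \<Rightarrow> ((nat \<Rightarrow> 'a process) \<times> (nat \<Rightarrow> 'a process)) set" where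
  "planner_budget_set M F T \<psi>x \<psi>c n w =
     {(x, C). (\<forall>i\<in>{1..n}. admissible M F T (x i) (C i)) \<and>
              (\<Sum>i=1..n. expenditure M T \<psi>x \<psi>c (x i) (C i)) \<le> ennreal w}"


section \<open>Payoffs, the social planner and the contribution game\<close>

definition payoff ::
    "'a measure \<Rightarrow> ereal \<Rightarrow> 'a process \<Rightarrow> (real \<times> real \<Rightarrow> real)
     \<Rightarrow> 'a process \<Rightarrow> 'a process \<Rightarrow> 'a process \<Rightarrow> ennreal" where
  "payoff M T r u x C C' =
     (\<integral>\<^sup>+\<omega>. (\<integral>\<^sup>+s. ennreal (discount r s \<omega> *
        u (x (ereal s) \<omega>, C (ereal s) \<omega> + C' (ereal s) \<omega>)) \<partial>dt T) \<partial>M)"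

definition others :: "nat \<Rightarrow> nat \<Rightarrow> (nat \<Rightarrow> 'a process) \<Rightarrow> 'a process" where
  "others n i C = (\<lambda>t \<omega>. \<Sum>j\<in>{1..n} - {i}. C j t \<omega>)"

definition welfare ::
    "'a measure \<Rightarrow> ereal \<Rightarrow> 'a process \<Rightarrow> nat \<Rightarrow> (nat \<Rightarrow> real) \<Rightarrow> (nat \<Rightarrow> real \<times> real \<Rightarrow> real)
     \<Rightarrow> (nat \<Rightarrow> 'a process) \<Rightarrow> (nat \<Rightarrow> 'a process) \<Rightarrow> ennreal" where
  "welfare M T r n \<gamma> u x C =
     (\<Sum>i=1..n. ennreal (\<gamma> i) * payoff M T r (u i) (x i) (C i) (others n i C))"

definition planner_solution ::
    "'a measure \<Rightarrow> (ereal \<Rightarrow> 'a measure) \<Rightarrow> ereal \<Rightarrow> 'a process \<Rightarrow> 'a process \<Rightarrow> 'a process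
     \<Rightarrow> nat \<Rightarrow> (nat \<Rightarrow> real) \<Rightarrow> (nat \<Rightarrow> real \<times> real \<Rightarrow> real) \<Rightarrow> (nat \<Rightarrow> real)
     \<Rightarrow> (nat \<Rightarrow> 'a process) \<Rightarrow> (nat \<Rightarrow> 'a process) \<Rightarrow> bool" where
  "planner_solution M F T \<psi>x \<psi>c r n w u \<gamma> x C \<longleftrightarrow>
     (x, C) \<in> planner_budget_set M F T \<psi>x \<psi>c n (\<Sum>i=1..n. w i) \<and>
     welfare M T r n \<gamma> u x C =
       (SUP (y, D)\<in>planner_budget_set M F T \<psi>x \<psi>c n (\<Sum>i=1..n. w i). welfare M T r n \<gamma> u y D)"

definition best_value ::
    "'a measure \<Rightarrow> (ereal \<Rightarrow> 'a measure) \<Rightarrow> ereal \<Rightarrow> 'a process \<Rightarrow> 'a process \<Rightarrow> 'a process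
     \<Rightarrow> real \<Rightarrow> (real \<times> real \<Rightarrow> real) \<Rightarrow> 'a process \<Rightarrow> ennreal" where
  "best_value M F T \<psi>x \<psi>c r w u C' =
     (SUP (x, C)\<in>budget_set M F T \<psi>x \<psi>c w. payoff M T r u x C C')"

definition nash_equilibrium ::
    "'a measure \<Rightarrow> (ereal \<Rightarrow> 'a measure) \<Rightarrow> ereal \<Rightarrow> 'a process \<Rightarrow> 'a process \<Rightarrow> 'a process
     \<Rightarrow> nat \<Rightarrow> (nat \<Rightarrow> real) \<Rightarrow> (nat \<Rightarrow> real \<times> real \<Rightarrow> real)
     \<Rightarrow> (nat \<Rightarrow> 'a process) \<Rightarrow> (nat \<Rightarrow> 'a process) \<Rightarrow> bool" where
  "nash_equilibrium M F T \<psi>x \<psi>c r n w u x C \<longleftrightarrow>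
     (\<forall>i\<in>{1..n}. (x i, C i) \<in> budget_set M F T \<psi>x \<psi>c (w i) \<and>
        payoff M T r (u i) (x i) (C i) (others n i C) =
          best_value M F T \<psi>x \<psi>c r (w i) (u i) (others n i C))"


section \<open>Assumptions on utilities\<close>

definition partial_x :: "(real \<times> real \<Rightarrow> real) \<Rightarrow> real \<times> real \<Rightarrow> real" where
  "partial_x f = (\<lambda>(x, c). deriv (\<lambda>y. f (y, c)) x)"

definition partial_c :: "(real \<times> real \<Rightarrow> real) \<Rightarrow> real \<times> real \<Rightarrow> real" where
  "partial_c f = (\<lambda>(x, c). deriv (\<lambda>d. f (x, d)) c)"

definition C1_on :: "(real \<times> real) set \<Rightarrow> (real \<times> real \<Rightarrow> real) \<Rightarrow> bool" where
  "C1_on S f \<longleftrightarrow>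
     (\<forall>(x, c)\<in>S. (\<lambda>y. f (y, c)) differentiable at x \<and> (\<lambda>d. f (x, d)) differentiable at c) \<and>
     continuous_on S (partial_x f) \<and> continuous_on S (partial_c f)"

definition C2_on :: "(real \<times> real) set \<Rightarrow> (real \<times> real \<Rightarrow> real) \<Rightarrow> bool" where
  "C2_on S f \<longleftrightarrow> C1_on S f \<and> C1_on S (partial_x f) \<and> C1_on S (partial_c f)"

definition negative_definite_hessian :: "(real \<times> real \<Rightarrow> real) \<Rightarrow> real \<times> real \<Rightarrow> bool" where
  "negative_definite_hessian f p \<longleftrightarrow>
     (\<forall>a b. (a, b) \<noteq> (0, 0) \<longrightarrow>
        a * a * partial_x (partial_x f) p + a * b * partial_c (partial_x f) p
        + b * a * partial_x (partial_c f) p + b * b * partial_c (partial_c f) p < 0)"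

definition strictly_concave_on :: "'b::real_vector set \<Rightarrow> ('b \<Rightarrow> real) \<Rightarrow> bool" where
  "strictly_concave_on S f \<longleftrightarrow> convex S \<and>
     (\<forall>p\<in>S. \<forall>q\<in>S. p \<noteq> q \<longrightarrow>
        (\<forall>t\<in>{0<..<1}. (1 - t) * f p + t * f q < f ((1 - t) *\<^sub>R p + t *\<^sub>R q)))"

definition regular_utility :: "(real \<times> real \<Rightarrow> real) \<Rightarrow> bool" where
  "regular_utility u \<longleftrightarrow>
     (\<forall>p\<in>{0..} \<times> {0..}. 0 \<le> u p) \<and>
     (\<forall>x c y d. 0 \<le> x \<longrightarrow> x \<le> y \<longrightarrow> 0 \<le> c \<longrightarrow> c \<le> d \<longrightarrow> u (x, c) \<le> u (y, d)) \<and>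
     strictly_concave_on ({0..} \<times> {0..}) u \<and>
     C2_on ({0<..} \<times> {0<..}) u \<and>
     (\<forall>p\<in>{0<..} \<times> {0<..}. negative_definite_hessian u p) \<and>
     (\<forall>c>0. filterlim (\<lambda>x. partial_x u (x, c)) at_top (at_right 0) \<and>
            ((\<lambda>x. partial_x u (x, c)) \<longlongrightarrow> 0) at_top)"

definition assumption_U ::
    "'a measure \<Rightarrow> (ereal \<Rightarrow> 'a measure) \<Rightarrow> ereal \<Rightarrow> 'a process \<Rightarrow> 'a process \<Rightarrow> 'a process
     \<Rightarrow> nat \<Rightarrow> (nat \<Rightarrow> real) \<Rightarrow> (nat \<Rightarrow> real \<times> real \<Rightarrow> real) \<Rightarrow> bool" where
  "assumption_U M F T \<psi>x \<psi>c r n w u \<longleftrightarrow>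
     (\<forall>i\<in>{1..n}. regular_utility (u i)) \<and>
     (\<forall>i\<in>{1..n}. uniformly_integrable (M \<Otimes>\<^sub>M dt T)
        {(\<lambda>(\<omega>, s). discount r s \<omega> * u i (x i (ereal s) \<omega>, \<Sum>j=1..n. C j (ereal s) \<omega>)) | x C.
           \<forall>j\<in>{1..n}. (x j, C j) \<in> budget_set M F T \<psi>x \<psi>c (w j)})"


section \<open>Assumptions on prices\<close>

definition price_process ::
    "'a measure \<Rightarrow> (ereal \<Rightarrow> 'a measure) \<Rightarrow> ereal \<Rightarrow> 'a process \<Rightarrow> bool" where
  "price_process M F T \<psi> \<longleftrightarrow>
     adapted F T \<psi> \<and>
     (\<forall>\<omega>\<in>space M. right_continuous_path T (\<lambda>t. \<psi> t \<omega>)) \<and>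
     (\<forall>t\<in>finite_times T. \<forall>\<omega>\<in>space M. 0 < \<psi> t \<omega>) \<and>
     (\<exists>\<rho> \<E>. (\<lambda>(\<omega>, s). \<rho> (ereal s) \<omega>) \<in> borel_measurable (M \<Otimes>\<^sub>M dt T) \<and>
        bounded_positive M T \<rho> \<and> exponential_martingale M F T \<E> \<and>
        (\<forall>s. ereal s \<in> finite_times T \<longrightarrow>
           (AE \<omega> in M. \<psi> (ereal s) \<omega> = discount \<rho> s \<omega> * \<E> (ereal s) \<omega>)))"

definition assumption_P ::
    "'a measure \<Rightarrow> (ereal \<Rightarrow> 'a measure) \<Rightarrow> ereal \<Rightarrow> 'a process \<Rightarrow> 'a process \<Rightarrow> 'a process \<Rightarrow> bool" where
  "assumption_P M F T \<psi>x \<psi>c r \<longleftrightarrow>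
     price_process M F T \<psi>c \<and> (T = \<infinity> \<longrightarrow> (AE \<omega> in M. \<psi>c T \<omega> = 0)) \<and>
     price_process M F T \<psi>x \<and>
     optional_process M F T r \<and> bounded_positive M T r"

end

(*
  Write everything per agent: (X, A) for the planner's symmetric solution and (Y, B) for the
  symmetric equilibrium, so that the public good is n A and n B. Suppose the planner did not spend
  more on the public good. Then an agent of the game can afford the consumption
  (1 - 1/n) Y + (1/n) X together with the contribution A, and the resulting pair (consumption, public
  good) is the convex combination with weights 1 - 1/n and 1/n of the equilibrium and of the planner's
  solution. The planner's payoff is at least that of the equilibrium, so strict concavity forces
  (X, A) = (Y, B) almost everywhere. At such a common point consumption is positive wherever A is, by
  the Inada condition, and u is differentiable there. The planner's shift of expenditure towards the
  public good and the agent's shift of the same proportion away from it are both unprofitable, but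
  the agent's shift changes the public good by a factor n less; the sum of the two directional
  derivatives is that of a pure increase of the public good, hence positive, a contradiction.
*)

theory Submission
  imports Defs
begin

section \<open>Utility functions\<close>

text \<open>No first-order condition for the contributions is derived: apart from leaving a
  contribution unchanged, every deviation multiplies a given contribution process by a constant.
  This keeps it optional, nondecreasing and right-continuous, and scales its cost exactly. The
  planner's and the agent's moves enter only through their sum, in which the marginal utility of
  consumption cancels pointwise, before any integration. Two obstacles shape the rest. Utility is
  differentiable only inside the quadrant, so the final pair of moves touches consumption only where
  \<open>A\<close> is positive. And the difference quotients must pass to the limit without a bound
  on derivatives: concavity together with \<open>u (0, 0) \<ge> 0\<close> bounds each of them below
  by a fixed negative multiple of the utility flow at the optimum, which is integrable, so that
  Fatou's lemma applies. The equality of \<open>(X, A)\<close> and \<open>(Y, B)\<close> holds only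
  up to \<open>P \<otimes> dt\<close>-null sets. A jump at the horizon can still make the
  contribution costs differ; the inequality assumed for contradiction has the direction that the
  agent's budget requires.\<close>

lemma regular_utility_nonneg:
  assumes "regular_utility u" "0 \<le> x" "0 \<le> c"
  shows "0 \<le> u (x, c)"
  using assms by (auto simp: regular_utility_def)

lemma regular_utility_mono:
  assumes "regular_utility u" "0 \<le> x" "x \<le> y" "0 \<le> c" "c \<le> d"
  shows "u (x, c) \<le> u (y, d)"
  using assms by (auto simp: regular_utility_def)

lemma regular_utility_strictly_concave:
  assumes u: "regular_utility u" and "0 \<le> x" "0 \<le> c" "0 \<le> y" "0 \<le> d" "0 < t" "t < 1"
    and "(x, c) \<noteq> (y, d)"
  shows "(1 - t) * u (x, c) + t * u (y, d) < u ((1 - t) * x + t * y, (1 - t) * c + t * d)"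
proof -
  have "\<forall>p\<in>{0..} \<times> {0..}. \<forall>q\<in>{0..} \<times> {0..}. p \<noteq> q \<longrightarrow>
        (\<forall>t\<in>{0<..<1}. (1 - t) * u p + t * u q < u ((1 - t) *\<^sub>R p + t *\<^sub>R q))"
    using u unfolding regular_utility_def strictly_concave_on_def by (elim conjE)
  from this[rule_format, of "(x, c)" "(y, d)" t] show ?thesis using assms by auto
qed

lemma regular_utility_concave:
  assumes u: "regular_utility u" and "0 \<le> x" "0 \<le> c" "0 \<le> y" "0 \<le> d" "0 \<le> t" "t \<le> 1"
  shows "(1 - t) * u (x, c) + t * u (y, d) \<le> u ((1 - t) * x + t * y, (1 - t) * c + t * d)"
proof (cases "t = 0 \<or> t = 1 \<or> (x, c) = (y, d)")
  case True
  then show ?thesis by (auto simp flip: distrib_right)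
next
  case False
  then have "0 < t" "t < 1" using assms by auto
  with regular_utility_strictly_concave[OF u] assms False show ?thesis by (meson less_imp_le)
qed

text \<open>\<open>(y, d)\<close> is the midpoint of \<open>(x, c)\<close> and its reflection
  \<open>(2 * y - x, 2 * d - c)\<close>, which dominates \<open>(y, d)\<close>. Strict concavity at
  the midpoint therefore upgrades weak monotonicity.\<close>

lemma regular_utility_strict_mono:
  assumes u: "regular_utility u" and "0 \<le> x" "x \<le> y" "0 \<le> c" "c \<le> d" "x < y \<or> c < d"
  shows "u (x, c) < u (y, d)"
proof -
  have "(1 - 1/2) * u (x, c) + 1/2 * u (2 * y - x, 2 * d - c)
    < u ((1 - 1/2) * x + 1/2 * (2 * y - x), (1 - 1/2) * c + 1/2 * (2 * d - c))"
    using assms by (intro regular_utility_strictly_concave) auto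
  moreover have "(1 - 1/2) * x + 1/2 * (2 * y - x) = y" "(1 - 1/2) * c + 1/2 * (2 * d - c) = d"
    by (auto simp: field_simps)
  moreover have "u (y, d) \<le> u (2 * y - x, 2 * d - c)"
    using assms by (intro regular_utility_mono) auto
  ultimately show ?thesis by simp
qed

text \<open>Concavity on the segment to the origin, where utility is nonnegative. In the form
  \<open>u (y, d) - u (x, c) \<ge> - t * u (x, c)\<close> this is the lower bound on difference
  quotients that Fatou's lemma needs.\<close>

lemma regular_utility_shrink:
  assumes u: "regular_utility u" and "0 \<le> x" "0 \<le> c" "0 \<le> t" "t \<le> 1"
    and "(1 - t) * x \<le> y" "(1 - t) * c \<le> d"
  shows "(1 - t) * u (x, c) \<le> u (y, d)"
proof -
  have "(1 - t) * u (x, c) \<le> (1 - t) * u (x, c) + t * u (0, 0)"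
    using assms regular_utility_nonneg[OF u, of 0 0] by simp
  also have "\<dots> \<le> u ((1 - t) * x + t * 0, (1 - t) * c + t * 0)"
    using assms by (intro regular_utility_concave) auto
  also have "\<dots> \<le> u (y, d)" using assms by (intro regular_utility_mono) auto
  finally show ?thesis .
qed

text \<open>\<open>C1_on\<close> speaks of partial derivatives only; continuity of the partial in
  \<open>c\<close> makes the function jointly differentiable.
  \<open>has_derivative_partialsI\<close> takes that partial as a bounded linear map, hence
  \<open>blinfun_scaleR_right\<close>.\<close>

lemma regular_utility_has_derivative:
  assumes u: "regular_utility u" and x: "0 < x" and c: "0 < c"
  shows "(u has_derivative (\<lambda>(h, k). partial_x u (x, c) * h + partial_c u (x, c) * k)) (at (x, c))"
proof -
  define S where "S = ({0<..} :: real set)"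
  have C1: "C1_on (S \<times> S) u" using u by (simp add: regular_utility_def C2_on_def S_def)
  have dx: "((\<lambda>y. u (y, d)) has_field_derivative partial_x u (y, d)) (at y)" if "y \<in> S" "d \<in> S" for y d
    using C1 that unfolding C1_on_def partial_x_def by (fastforce intro: DERIV_deriv_iff_real_differentiable[THEN iffD2])
  have dc: "((\<lambda>d. u (y, d)) has_field_derivative partial_c u (y, d)) (at d)" if "y \<in> S" "d \<in> S" for y d
    using C1 that unfolding C1_on_def partial_c_def by (fastforce intro: DERIV_deriv_iff_real_differentiable[THEN iffD2])
  have cont: "continuous_on (S \<times> S) (partial_c u)" using C1 by (simp add: C1_on_def)
  have xc: "x \<in> S" "c \<in> S" using x c by (auto simp: S_def)
  have op: "open S" by (simp add: S_def)
  have "((\<lambda>(y, d). (\<lambda>y d. u (y, d)) y d) has_derivative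
      (\<lambda>(h, k). partial_x u (x, c) * h + (\<lambda>y d. blinfun_scaleR_right (partial_c u (y, d))) x c k))
      (at (x, c) within S \<times> S)"
  proof (rule has_derivative_partialsI)
    show "((\<lambda>y. u (y, c)) has_derivative (*) (partial_x u (x, c))) (at x within S)"
      using dx[OF xc] by (simp add: has_field_derivative_def has_derivative_at_withinI)
    show "((\<lambda>d. u (y, d)) has_derivative blinfun_apply (blinfun_scaleR_right (partial_c u (y, d)))) (at d within S)"
      if "y \<in> S" "d \<in> S" for y d
    proof -
      have "(*\<^sub>R) (partial_c u (y, d)) = (*) (partial_c u (y, d))" by (intro ext) simp
      then show ?thesis
        using dc[OF that] by (simp add: has_field_derivative_def has_derivative_at_withinI)
    qed
    have "continuous_on (S \<times> S) (\<lambda>p. blinfun_scaleR_right (partial_c u p) :: real \<Rightarrow>\<^sub>L real)"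
      by (intro bounded_linear.continuous_on[OF bounded_linear_blinfun_scaleR_right] cont)
    then show "continuous (at (x, c) within S \<times> S) (\<lambda>(y, d). blinfun_scaleR_right (partial_c u (y, d)) :: real \<Rightarrow>\<^sub>L real)"
      using xc by (auto simp: continuous_on_eq_continuous_within case_prod_unfold)
  qed (use xc in \<open>auto simp: S_def\<close>)
  moreover have "at (x, c) within S \<times> S = at (x, c)"
    using xc op by (intro at_within_open) (auto intro: open_Times)
  ultimately show ?thesis by (simp add: case_prod_unfold)
qed

text \<open>By concavity in \<open>c\<close> the tangent at \<open>c\<close> lies above the graph,
  so the slope is at least the strictly positive increment from \<open>c\<close> to
  \<open>c + 1\<close>.\<close>

lemma regular_utility_partial_c_pos:
  assumes u: "regular_utility u" and x: "0 < x" and c: "0 < c"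
  shows "0 < partial_c u (x, c)"
proof -
  have "((\<lambda>d. u (x, d)) has_derivative (\<lambda>k. (\<lambda>(h, k). partial_x u (x, c) * h + partial_c u (x, c) * k) (0, k))) (at c)"
    by (rule has_derivative_compose[where f="\<lambda>d. (x, d)" and g=u])
       (auto intro!: derivative_eq_intros regular_utility_has_derivative u x c)
  then have D: "((\<lambda>d. u (x, d)) has_field_derivative partial_c u (x, c)) (at c)"
    by (simp add: has_field_derivative_def mult_commute_abs)
  have D': "((\<lambda>d. - u (x, d)) has_field_derivative - partial_c u (x, c)) (at c within {0<..})"
    using DERIV_subset[OF DERIV_minus[OF D]] by simp
  have "convex_on {0<..} (\<lambda>d. - u (x, d))"
  proof (rule convex_onI)
    fix t y z :: real assume "0 < t" "t < 1" "y \<in> {0<..}" "z \<in> {0<..}"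
    then show "- u (x, (1 - t) *\<^sub>R y + t *\<^sub>R z) \<le> (1 - t) * - u (x, y) + t * - u (x, z)"
      using regular_utility_concave[OF u, of x y x z t] x by (simp flip: distrib_right)
  qed simp
  then have "- u (x, c + 1) - - u (x, c) \<ge> - partial_c u (x, c) * (c + 1 - c)"
    by (rule convex_on_imp_above_tangent[OF _ _ _ _ D']) (use c in \<open>auto simp: interior_open\<close>)
  moreover have "u (x, c) < u (x, c + 1)"
    using u x c by (intro regular_utility_strict_mono) auto
  ultimately show ?thesis by simp
qed

text \<open>
  The planner moves along \<open>(-\<kappa> x, c)\<close>, an agent in the game along \<open>(\<kappa> x, -c/n)\<close>; the sum of the
  two directional derivatives is that in direction \<open>(0, (1 - 1/n) c)\<close>.
\<close>

lemma regular_utility_opposite_moves: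
  assumes u: "regular_utility u" and x: "0 < x" and c: "0 < c" and q: "q < 1"
  obtains L where "0 < L"
    "((\<lambda>e. (u (x * (1 - \<kappa> * e), c * (1 + e)) + u (x * (1 + \<kappa> * e), c * (1 - q * e)) - 2 * u (x, c)) / e)
       \<longlongrightarrow> L) (at_right 0)"
proof
  let ?a = "partial_x u (x, c)" and ?b = "partial_c u (x, c)"
  have D: "((\<lambda>e. u (x * (1 + p * e), c * (1 + s * e))) has_field_derivative ?a * (x * p) + ?b * (c * s)) (at 0)" for p s
  proof -
    have "((\<lambda>e. u (x * (1 + p * e), c * (1 + s * e))) has_derivative
       (\<lambda>e. (\<lambda>(h, k). ?a * h + ?b * k) (x * (p * e), c * (s * e)))) (at 0)"
      by (rule has_derivative_compose[where g=u and f="\<lambda>e. (x * (1 + p * e), c * (1 + s * e))"])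
         (auto intro!: derivative_eq_intros regular_utility_has_derivative u x c)
    then show ?thesis
      by (rule has_derivative_imp_has_field_derivative) (simp add: algebra_simps)
  qed
  have "((\<lambda>e. u (x * (1 - \<kappa> * e), c * (1 + e)) + u (x * (1 + \<kappa> * e), c * (1 - q * e)))
      has_field_derivative (?a * (x * - \<kappa>) + ?b * (c * 1)) + (?a * (x * \<kappa>) + ?b * (c * - q))) (at 0)"
    using DERIV_add[OF D[of "-\<kappa>" 1] D[of \<kappa> "-q"]] by simp
  then have "((\<lambda>e. (u (x * (1 - \<kappa> * e), c * (1 + e)) + u (x * (1 + \<kappa> * e), c * (1 - q * e)) - 2 * u (x, c)) / e)
       \<longlongrightarrow> ?b * c * (1 - q)) (at 0)"
    by (simp add: has_field_derivative_iff algebra_simps)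
  then show "((\<lambda>e. (u (x * (1 - \<kappa> * e), c * (1 + e)) + u (x * (1 + \<kappa> * e), c * (1 - q * e)) - 2 * u (x, c)) / e)
       \<longlongrightarrow> ?b * c * (1 - q)) (at_right 0)"
    by (rule filterlim_mono) (auto intro: at_le)
  show "0 < ?b * c * (1 - q)" using regular_utility_partial_c_pos[OF u x c] c q by simp
qed

text \<open>The point \<open>z = 0\<close> is included because concavity holds on the closed
  quadrant; this lets derivatives at positive consumption bound the utility at zero
  consumption.\<close>

lemma regular_utility_tangent_x:
  assumes u: "regular_utility u" and y: "0 < y" and c: "0 < c" and z: "0 \<le> z"
  shows "u (z, c) \<le> u (y, c) + partial_x u (y, c) * (z - y)"
proof -
  have "((\<lambda>z. u (z, c)) has_derivative (\<lambda>h. (\<lambda>(h, k). partial_x u (y, c) * h + partial_c u (y, c) * k) (h, 0))) (at y)"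
    using has_derivative_compose[where f="\<lambda>z. (z, c)" and g=u,
      OF has_derivative_Pair[OF has_derivative_ident has_derivative_const]
        regular_utility_has_derivative[OF u y c]] .
  then have "((\<lambda>z. u (z, c)) has_field_derivative partial_x u (y, c)) (at y)"
    by (simp add: has_field_derivative_def mult_commute_abs)
  from DERIV_subset[OF DERIV_minus[OF this]]
  have D: "((\<lambda>z. - u (z, c)) has_field_derivative - partial_x u (y, c)) (at y within {0..})" by simp
  have "convex_on {0..} (\<lambda>z. - u (z, c))"
  proof (rule convex_onI)
    fix t p q :: real assume "0 < t" "t < 1" "p \<in> {0..}" "q \<in> {0..}"
    then show "- u ((1 - t) *\<^sub>R p + t *\<^sub>R q, c) \<le> (1 - t) * - u (p, c) + t * - u (q, c)"
      using regular_utility_concave[OF u, of p c q c t] c by (simp flip: distrib_right)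
  qed simp
  then have "- u (z, c) - - u (y, c) \<ge> - partial_x u (y, c) * (z - y)"
    by (rule convex_on_imp_above_tangent[OF _ _ _ _ D]) (use y z in auto)
  then show ?thesis by simp
qed

text \<open>Starting from zero consumption, consumption \<open>e * k\<close> is bought by giving up
  the fraction \<open>e\<close> of the public good. The gain is \<open>e * k\<close> times a
  marginal utility that explodes, while the loss is of order \<open>e\<close>. The loss is estimated
  by concavity, since no derivative in \<open>c\<close> is at hand on the boundary.\<close>

lemma regular_utility_Inada:
  assumes u: "regular_utility u" and c: "0 < c" and k: "0 < k"
  shows "filterlim (\<lambda>e. (u (e * k, (1 - e) * c) - u (0, c)) / e) at_top (at_right 0)"
proof -
  \<comment> \<open>\<open>B\<close> is the loss \<open>- 2 * e * u (0, c)\<close> divided by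
    \<open>e\<close>. The factor \<open>k / 2\<close> below is \<open>y / e = k\<close> times the
    bound \<open>1 - 2 * e \<ge> 1/2\<close>, which is why \<open>e\<close> is kept below
    \<open>1/4\<close>.\<close>
  define B where "B = - 2 * u (0, c)"
  have lim: "filterlim (\<lambda>x. partial_x u (x, c)) at_top (at_right 0)"
    using u c by (simp add: regular_utility_def)
  have "filterlim (\<lambda>e. e * k) (at_right 0) (at_right 0)"
    unfolding filterlim_at using k
    by (auto intro!: tendsto_eq_intros simp: eventually_at_right_field intro!: exI[of _ 1])
  from filterlim_compose[OF lim this]
  have "filterlim (\<lambda>e. partial_x u (e * k, c)) at_top (at_right 0)" .
  then have "filterlim (\<lambda>e. (k / 2) * partial_x u (e * k, c)) at_top (at_right 0)"
    using k by (intro filterlim_tendsto_pos_mult_at_top[OF tendsto_const]) auto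
  then have top: "filterlim (\<lambda>e. B + (k / 2) * partial_x u (e * k, c)) at_top (at_right 0)"
    by (rule filterlim_tendsto_add_at_top[OF tendsto_const])
  have ev: "\<forall>\<^sub>F e in at_right 0. B + (k / 2) * partial_x u (e * k, c) \<le> (u (e * k, (1 - e) * c) - u (0, c)) / e"
    unfolding eventually_at_right_field
  proof (intro exI[of _ "1/4"] conjI allI impI)
    fix e :: real assume e: "0 < e" "e < 1/4"
    define y where "y = e * k"
    have y: "0 < y" using e k by (simp add: y_def)
    have tan: "u (0, c) + partial_x u (y, c) * y \<le> u (y, c)"
      using regular_utility_tangent_x[OF u y c, of 0] by simp
    have pos: "0 \<le> partial_x u (y, c)"
    proof -
      have "u (y, c) \<le> u (2 * y, c)" using y c by (intro regular_utility_mono[OF u]) auto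
      also have "\<dots> \<le> u (y, c) + partial_x u (y, c) * y"
        using regular_utility_tangent_x[OF u y c, of "2 * y"] y by simp
      finally show ?thesis using y by (simp add: zero_le_mult_iff)
    qed
    \<comment> \<open>The point \<open>(y, (1 - e) * c)\<close> is a convex combination of a point
      at the original level \<open>c\<close> and of \<open>(0, c / 2)\<close>: halving
      \<open>c\<close> with weight \<open>2 * e\<close> loses exactly \<open>e * c\<close>, and
      dividing \<open>y\<close> by \<open>1 - 2 * e\<close> compensates the weight.\<close>
    have "(1 - 2 * e) * u (y / (1 - 2 * e), c) + 2 * e * u (0, c / 2)
      \<le> u ((1 - 2 * e) * (y / (1 - 2 * e)) + 2 * e * 0, (1 - 2 * e) * c + 2 * e * (c / 2))"
      using e y c by (intro regular_utility_concave[OF u]) auto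
    also have "(1 - 2 * e) * (y / (1 - 2 * e)) + 2 * e * 0 = y" using e by simp
    also have "(1 - 2 * e) * c + 2 * e * (c / 2) = (1 - e) * c" by (simp add: algebra_simps)
    finally have 1: "(1 - 2 * e) * u (y / (1 - 2 * e), c) + 2 * e * u (0, c / 2) \<le> u (y, (1 - e) * c)" .
    have "u (y, c) \<le> u (y / (1 - 2 * e), c)"
      using e y c by (intro regular_utility_mono[OF u]) (auto simp: field_simps)
    then have "(1 - 2 * e) * u (y, c) \<le> (1 - 2 * e) * u (y / (1 - 2 * e), c)"
      using e by (intro mult_left_mono) auto
    moreover have "0 \<le> 2 * e * u (0, c / 2)" using e c regular_utility_nonneg[OF u, of 0 "c/2"] by simp
    moreover have "(1 - 2 * e) * (u (0, c) + partial_x u (y, c) * y) \<le> (1 - 2 * e) * u (y, c)"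
      using tan e by (intro mult_left_mono) auto
    moreover have "1/2 * (partial_x u (y, c) * y) \<le> (1 - 2 * e) * (partial_x u (y, c) * y)"
      using e y pos by (intro mult_right_mono) auto
    ultimately have "- 2 * e * u (0, c) + 1/2 * (partial_x u (y, c) * y) \<le> u (y, (1 - e) * c) - u (0, c)"
      using 1 by (simp add: algebra_simps)
    then show "B + (k / 2) * partial_x u (e * k, c) \<le> (u (e * k, (1 - e) * c) - u (0, c)) / e"
      using e by (simp add: B_def y_def field_simps)
  qed simp
  show ?thesis by (rule filterlim_at_top_mono[OF top ev])
qed

section \<open>Processes\<close>

lemma space_dt: "space (dt T) = {s. 0 \<le> s \<and> ereal s \<le> T}"
  by (simp add: dt_def space_restrict_space)

lemma time_set_borel [measurable]: "{s. 0 \<le> s \<and> ereal s \<le> T} \<in> sets borel"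
  by measurable

lemma sigma_finite_dt: "sigma_finite_measure (dt T)"
  unfolding dt_def
  by (rule sigma_finite_measure_restrict_space) (auto simp: lborel.sigma_finite_measure_axioms)

lemma nn_integral_dt:
  "(\<integral>\<^sup>+s. f s \<partial>dt T) = (\<integral>\<^sup>+s. indicator {s. 0 \<le> s \<and> ereal s \<le> T} s * f s \<partial>lborel)"
  unfolding dt_def by (subst nn_integral_restrict_space) (auto simp: mult.commute)

lemma pair_dt_to_pair_borel [measurable]: "(\<lambda>z. z) \<in> M \<Otimes>\<^sub>M dt T \<rightarrow>\<^sub>M M \<Otimes>\<^sub>M borel"
proof -
  have [measurable]: "(\<lambda>s. s) \<in> dt T \<rightarrow>\<^sub>M borel"
    unfolding dt_def by (intro measurable_restrict_space1) simp
  have "(\<lambda>z. (fst z, snd z)) \<in> M \<Otimes>\<^sub>M dt T \<rightarrow>\<^sub>M M \<Otimes>\<^sub>M borel"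
    by (intro measurable_Pair measurable_fst measurable_compose[OF measurable_snd]) measurable
  then show ?thesis by simp
qed

text \<open>
  A right-continuous process is the pointwise limit of its values at the next point of the grid
  \<open>{i/(m+1)}\<close>.
\<close>

lemma right_continuous_measurable_borel:
  fixes X :: "'a process"
  assumes T: "0 < T"
    and meas: "\<And>t. t \<in> {0..T} \<Longrightarrow> X t \<in> borel_measurable M"
    and rc: "\<And>\<omega>. \<omega> \<in> space M \<Longrightarrow> right_continuous_path T (\<lambda>t. X t \<omega>)"
  shows "(\<lambda>(\<omega>, s). indicator {s. 0 \<le> s \<and> ereal s \<le> T} s * X (ereal s) \<omega>) \<in> borel_measurable (M \<Otimes>\<^sub>M borel)"
proof -
  define S where "S = {s. 0 \<le> s \<and> ereal s \<le> T}"
  \<comment> \<open>With the \<open>+ 1\<close> the grid point lies strictly to the right of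
    \<open>s\<close> even if \<open>s\<close> is on the grid; \<open>at_right\<close> excludes
    \<open>s\<close> itself. The clamp \<open>\<tau>\<close> keeps the time in \<open>[0,T]\<close>,
    where \<open>X\<close> is known to be measurable.\<close>
  define g where "g m s = (real_of_int (\<lfloor>s * real (Suc m)\<rfloor> + 1)) / real (Suc m)" for m :: nat and s :: real
  define \<tau> where "\<tau> r = max 0 (min (ereal r) T)" for r
  have [measurable]: "S \<in> sets borel" unfolding S_def by measurable
  have \<tau>_in: "\<tau> r \<in> {0..T}" for r using T by (auto simp: \<tau>_def)
  have "(\<lambda>z. indicator S (snd z) * X (\<tau> (g m (snd z))) (fst z)) \<in> borel_measurable (M \<Otimes>\<^sub>M borel)" for m
  proof -
    define h where "h i z = indicator S (snd z) * X (\<tau> (real_of_int (i + 1) / real (Suc m))) (fst z)" for i z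
    \<comment> \<open>For a fixed grid index \<open>X\<close> is frozen at one time, and there are
      only countably many indices.\<close>
    have "(\<lambda>z. h \<lfloor>snd z * real (Suc m)\<rfloor> z) \<in> borel_measurable (M \<Otimes>\<^sub>M borel)"
    proof (rule measurable_compose_countable)
      fix i :: int
      have [measurable]: "X (\<tau> (real_of_int (i + 1) / real (Suc m))) \<in> borel_measurable M"
        by (rule meas[OF \<tau>_in])
      show "h i \<in> borel_measurable (M \<Otimes>\<^sub>M borel)"
        unfolding h_def by measurable
    qed measurable
    then show ?thesis by (simp add: g_def h_def)
  qed
  then have "(\<lambda>z. indicator S (snd z) * X (ereal (snd z)) (fst z)) \<in> borel_measurable (M \<Otimes>\<^sub>M borel)"
  proof (rule borel_measurable_LIMSEQ_real[rotated])
    fix z assume z: "z \<in> space (M \<Otimes>\<^sub>M (borel :: real measure))"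
    obtain \<omega> s where zs: "z = (\<omega>, s)" by (cases z)
    have \<omega>: "\<omega> \<in> space M" using z zs by (simp add: space_pair_measure)
    show "(\<lambda>m. indicator S (snd z) * X (\<tau> (g m (snd z))) (fst z)) \<longlonglongrightarrow> indicator S (snd z) * X (ereal (snd z)) (fst z)"
    proof (cases "s \<in> S")
      case False
      then show ?thesis by (simp add: zs)
    next
      case True
      have gs: "s < g m s" "g m s \<le> s + 1 / real (Suc m)" for m
      proof -
        have "s * real (Suc m) < real_of_int (\<lfloor>s * real (Suc m)\<rfloor> + 1)"
          using floor_correct[of "s * real (Suc m)"] by simp
        then show "s < g m s" unfolding g_def by (subst pos_less_divide_eq) simp_all
        have "real_of_int (\<lfloor>s * real (Suc m)\<rfloor> + 1) \<le> s * real (Suc m) + 1"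
          using floor_correct[of "s * real (Suc m)"] by simp
        then have "g m s \<le> (s * real (Suc m) + 1) / real (Suc m)"
          unfolding g_def by (intro divide_right_mono) auto
        also have "\<dots> = s + 1 / real (Suc m)" by (simp add: field_simps)
        finally show "g m s \<le> s + 1 / real (Suc m)" .
      qed
      have gl: "(\<lambda>m. g m s) \<longlonglongrightarrow> s"
      proof (rule tendsto_sandwich[of "\<lambda>_. s" _ _ "\<lambda>m. s + 1 / real (Suc m)"])
        show "(\<lambda>m. s + 1 / real (Suc m)) \<longlonglongrightarrow> s"
          using tendsto_add[OF tendsto_const LIMSEQ_inverse_real_of_nat, of s] by (simp add: inverse_eq_divide)
      qed (use gs in \<open>auto intro!: always_eventually less_imp_le\<close>)
      have "(\<lambda>m. X (\<tau> (g m s)) \<omega>) \<longlonglongrightarrow> X (ereal s) \<omega>"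
      proof (cases "ereal s = T")
        case True
        \<comment> \<open>There is no right limit at \<open>T\<close>; the clamp makes the
          approximation exact there.\<close>
        have "\<tau> (g m s) = T" for m
          using gs(1)[of m] True T unfolding \<tau>_def
          by (metis ereal_less_eq(3) less_imp_le max.absorb2 min.absorb2)
        then show ?thesis by (simp add: True)
      next
        case False
        then have sT: "ereal s < T" "0 \<le> s" using \<open>s \<in> S\<close> by (auto simp: S_def)
        have lt: "ereal s < \<tau> (g m s)" for m
          using gs(1)[of m] sT by (auto simp: \<tau>_def less_max_iff_disj)
        have "(\<lambda>m. ereal (g m s)) \<longlonglongrightarrow> ereal s" by (rule tendsto_ereal[OF gl])
        then have "(\<lambda>m. \<tau> (g m s)) \<longlonglongrightarrow> max 0 (min (ereal s) T)"
          unfolding \<tau>_def by (intro tendsto_max tendsto_min tendsto_const)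
        moreover have "max 0 (min (ereal s) T) = ereal s" using sT less_imp_le[OF sT(1)] by (simp add: max_def min_def)
        ultimately have "filterlim (\<lambda>m. \<tau> (g m s)) (at_right (ereal s)) sequentially"
          unfolding filterlim_at using lt by (auto intro!: always_eventually simp: less_imp_neq[symmetric])
        moreover have "((\<lambda>t. X t \<omega>) \<longlongrightarrow> X (ereal s) \<omega>) (at_right (ereal s))"
          using rc[OF \<omega>] sT by (simp add: right_continuous_path_def)
        ultimately show ?thesis by (rule filterlim_compose[rotated])
      qed
      then show ?thesis by (simp add: zs tendsto_mult_left)
    qed
  qed
  then show ?thesis by (simp add: S_def case_prod_unfold)
qed

lemma right_continuous_measurable_dt:
  fixes X :: "'a process"
  assumes "0 < T" "\<And>t. t \<in> {0..T} \<Longrightarrow> X t \<in> borel_measurable M"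
    and "\<And>\<omega>. \<omega> \<in> space M \<Longrightarrow> right_continuous_path T (\<lambda>t. X t \<omega>)"
  shows "(\<lambda>z. X (ereal (snd z)) (fst z)) \<in> borel_measurable (M \<Otimes>\<^sub>M dt T)"
proof -
  have "(\<lambda>z. indicator {s. 0 \<le> s \<and> ereal s \<le> T} (snd z) * X (ereal (snd z)) (fst z)) \<in> borel_measurable (M \<Otimes>\<^sub>M dt T)"
    using measurable_compose[OF pair_dt_to_pair_borel right_continuous_measurable_borel[OF assms]]
    by (simp add: case_prod_unfold)
  then show ?thesis
    by (rule measurable_cong[THEN iffD1, rotated]) (auto simp: space_pair_measure space_dt)
qed

section \<open>Measurability of optional processes\<close>

context usual_filtered_prob_space
begin

lemma adapted_measurable: "adapted F T X \<Longrightarrow> t \<in> {0..T} \<Longrightarrow> X t \<in> borel_measurable M"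
  using subalgebra_F[of t] unfolding adapted_def by (blast intro: measurable_from_subalg)

lemma space_optional_algebra: "space (optional_algebra M F T) = space M \<times> {0..T}"
  unfolding optional_algebra_def by (rule space_measure_of) auto

lemma optional_algebra_section: "t \<in> {0..T} \<Longrightarrow> (\<lambda>\<omega>. (\<omega>, t)) \<in> M \<rightarrow>\<^sub>M optional_algebra M F T"
  unfolding optional_algebra_def
proof (rule measurable_measure_of, safe)
  fix X and B :: "real set" assume t: "t \<in> {0..T}" and X: "adapted F T X" and B: "B \<in> sets borel"
  have "X t -` B \<inter> space M \<in> sets M"
    by (rule measurable_sets[OF adapted_measurable[OF X t] B])
  also have "X t -` B \<inter> space M
      = (\<lambda>\<omega>. (\<omega>, t)) -` ((\<lambda>(\<omega>, t). X t \<omega>) -` B \<inter> space M \<times> {0..T}) \<inter> space M"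
    using t by auto
  finally show "(\<lambda>\<omega>. (\<omega>, t)) -` ((\<lambda>(\<omega>, t). X t \<omega>) -` B \<inter> space M \<times> {0..T}) \<inter> space M \<in> sets M" .
qed

text \<open>It suffices to test the generators, and adapted cadlag processes are jointly measurable
  by right continuity. Hence every optional process is a measurable function on
  \<open>M \<Otimes>\<^sub>M dt T\<close>.\<close>

lemma optional_algebra_pair: "(\<lambda>z. (fst z, ereal (snd z))) \<in> M \<Otimes>\<^sub>M dt T \<rightarrow>\<^sub>M optional_algebra M F T"
  unfolding optional_algebra_def
proof (rule measurable_measure_of, safe)
  fix X and B :: "real set"
  assume X: "adapted F T X" "\<forall>\<omega>\<in>space M. cadlag_path T (\<lambda>t. X t \<omega>)" and B: "B \<in> sets borel"
  have "(\<lambda>z. X (ereal (snd z)) (fst z)) \<in> borel_measurable (M \<Otimes>\<^sub>M dt T)"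
    using X by (intro right_continuous_measurable_dt horizon_pos adapted_measurable) (auto simp: cadlag_path_def)
  from measurable_sets[OF this B]
  have "(\<lambda>z. X (ereal (snd z)) (fst z)) -` B \<inter> space (M \<Otimes>\<^sub>M dt T) \<in> sets (M \<Otimes>\<^sub>M dt T)" .
  also have "(\<lambda>z. X (ereal (snd z)) (fst z)) -` B \<inter> space (M \<Otimes>\<^sub>M dt T)
    = (\<lambda>z. (fst z, ereal (snd z))) -` ((\<lambda>(\<omega>, t). X t \<omega>) -` B \<inter> space M \<times> {0..T}) \<inter> space (M \<Otimes>\<^sub>M dt T)"
    by (auto simp: space_pair_measure space_dt)
  finally show "(\<lambda>z. (fst z, ereal (snd z))) -` ((\<lambda>(\<omega>, t). X t \<omega>) -` B \<inter> space M \<times> {0..T}) \<inter> space (M \<Otimes>\<^sub>M dt T)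
    \<in> sets (M \<Otimes>\<^sub>M dt T)" .
qed (auto simp: space_pair_measure space_dt)

lemma optional_measurable: "optional_process M F T X \<Longrightarrow> t \<in> {0..T} \<Longrightarrow> X t \<in> borel_measurable M"
  using measurable_compose[OF optional_algebra_section, of t "\<lambda>(\<omega>, t). X t \<omega>" borel]
  by (simp add: optional_process_def)

lemma optional_measurable_dt:
  "optional_process M F T X \<Longrightarrow> (\<lambda>z. X (ereal (snd z)) (fst z)) \<in> borel_measurable (M \<Otimes>\<^sub>M dt T)"
  using measurable_compose[OF optional_algebra_pair, of "\<lambda>(\<omega>, t). X t \<omega>" borel]
  by (simp add: optional_process_def)

text \<open>This stream finances deviations in consumption: for \<open>a > 0\<close> it is positive
  at every finite time, yet integrable over an infinite horizon. The value at
  \<open>\<infinity>\<close> is set by hand because \<open>real_of_ereal \<infinity>\<close> is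
  0.\<close>

lemma optional_exp_decay:
  "optional_process M F T (\<lambda>t \<omega>. if t = \<infinity> then 0 else a * exp (- real_of_ereal t))"
proof -
  define X :: "'a process" where "X = (\<lambda>t \<omega>. if t = \<infinity> then 0 else exp (- real_of_ereal t))"
  have "adapted F T X" by (simp add: adapted_def X_def)
  moreover have "cadlag_path T (\<lambda>t. X t \<omega>)" for \<omega>
    unfolding cadlag_path_def right_continuous_path_def
  proof safe
    fix t assume "t \<in> {0..<T}"
    then obtain s where s: "t = ereal s" by (cases t) auto
    have "((\<lambda>s. exp (- s)) \<longlongrightarrow> exp (- s)) (at_right s)" by (intro tendsto_intros)
    then show "((\<lambda>t. X t \<omega>) \<longlongrightarrow> X t \<omega>) (at_right t)"
      by (simp add: s X_def at_right_ereal filterlim_filtermap)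
  next
    fix t assume "t \<in> {0<..T}"
    then consider s where "t = ereal s" | "t = \<infinity>" by (cases t) auto
    then show "\<exists>l. ((\<lambda>t. X t \<omega>) \<longlongrightarrow> l) (at_left t)"
    proof cases
      case (1 s)
      have "((\<lambda>s. exp (- s)) \<longlongrightarrow> exp (- s)) (at_left s)" by (intro tendsto_intros)
      then show ?thesis by (auto simp: 1 X_def at_left_ereal filterlim_filtermap)
    next
      case 2
      have "((\<lambda>s::real. exp (- s)) \<longlongrightarrow> 0) at_top"
        by (intro filterlim_compose[OF exp_at_bot] filterlim_uminus_at_bot_at_top)
      then show ?thesis by (auto simp: 2 X_def at_left_PInf filterlim_filtermap)
    qed
  qed
  ultimately have "(\<lambda>(\<omega>, t). X t \<omega>) -` B \<inter> (space M \<times> {0..T}) \<in> sets (optional_algebra M F T)"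
    if "B \<in> sets borel" for B :: "real set"
    unfolding optional_algebra_def using that by (subst sets_measure_of) auto
  then have "(\<lambda>(\<omega>, t). X t \<omega>) \<in> borel_measurable (optional_algebra M F T)"
    by (intro measurableI) (auto simp: space_optional_algebra)
  then have "(\<lambda>z. a * (\<lambda>(\<omega>, t). X t \<omega>) z) \<in> borel_measurable (optional_algebra M F T)"
    by (intro borel_measurable_times) auto
  moreover have "(\<lambda>z. a * (\<lambda>(\<omega>, t). X t \<omega>) z)
    = (\<lambda>(\<omega>, t). if t = \<infinity> then 0 else a * exp (- real_of_ereal t))"
    by (auto simp: X_def fun_eq_iff)
  ultimately show ?thesis by (simp add: optional_process_def)
qed

text \<open>Completeness of \<open>M\<close> is what makes this true. Admissible paths are regular
  only almost surely, so their Stieltjes integrals are first treated after a change on a null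
  set.\<close>

lemma borel_measurable_AE_eq:
  fixes f g :: "'a \<Rightarrow> 'b::topological_space"
  assumes g: "g \<in> borel_measurable M" and eq: "AE \<omega> in M. f \<omega> = g \<omega>"
  shows "f \<in> borel_measurable M"
proof (rule measurableI)
  fix B :: "'b set" assume B: "B \<in> sets borel"
  from eq obtain N where N: "{\<omega>\<in>space M. f \<omega> \<noteq> g \<omega>} \<subseteq> N" "N \<in> null_sets M"
    by (auto elim!: AE_E simp: null_sets_def)
  have "f -` B \<inter> space M = (g -` B \<inter> space M - N) \<union> (f -` B \<inter> space M \<inter> N)"
    using N(1) by auto
  moreover have "f -` B \<inter> space M \<inter> N \<in> sets M"
    using N(2) by (auto intro: complete)
  moreover have "g -` B \<inter> space M - N \<in> sets M"
    using measurable_sets[OF g B] N(2) by auto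
  ultimately show "f -` B \<inter> space M \<in> sets M" by (metis sets.Un)
qed simp

end

section \<open>Stieltjes integrals\<close>

definition stieltjes_path :: "ereal \<Rightarrow> (ereal \<Rightarrow> real) \<Rightarrow> bool" where
  "stieltjes_path T C \<longleftrightarrow> right_continuous_path T C \<and> mono_on {0..T} C \<and> (\<forall>t\<in>{0..T}. 0 \<le> C t)"

text \<open>The integrator inside \<open>stieltjes_integral\<close>, named so that the monotonicity
  and right continuity required by \<open>interval_measure\<close> can be proved on the whole real
  line.\<close>

definition extended_path :: "ereal \<Rightarrow> (ereal \<Rightarrow> real) \<Rightarrow> real \<Rightarrow> real" where
  "extended_path T C = (\<lambda>s. if s < 0 then 0 else C (min (ereal s) T))"

lemma stieltjes_path_scale:
  "stieltjes_path T C \<Longrightarrow> 0 \<le> a \<Longrightarrow> stieltjes_path T (\<lambda>t. a * C t)"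
  by (auto simp: stieltjes_path_def right_continuous_path_def mono_on_def
      intro!: mult_left_mono tendsto_intros)

context
  fixes T :: ereal and C
  assumes T: "0 < T" and C: "stieltjes_path T C"
begin

lemma extended_path_nonneg: "0 \<le> extended_path T C s"
  using T C by (auto simp: extended_path_def stieltjes_path_def)

lemma extended_path_mono: "s \<le> t \<Longrightarrow> extended_path T C s \<le> extended_path T C t"
proof (cases "s < 0")
  case True
  then show ?thesis using extended_path_nonneg[of t] by (simp add: extended_path_def)
next
  case False
  assume st: "s \<le> t"
  have "C (min (ereal s) T) \<le> C (min (ereal t) T)"
    by (rule mono_onD[of "{0..T}"]) (use T C False st in \<open>auto simp: stieltjes_path_def min.coboundedI1\<close>)
  with False st show ?thesis by (simp add: extended_path_def)
qed

lemma extended_path_right_continuous: "continuous (at_right s) (extended_path T C)"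
proof -
  let ?G = "extended_path T C"
  consider "s < 0" | "0 \<le> s" "ereal s < T" | "0 \<le> s" "T \<le> ereal s" by fastforce
  then have "(?G \<longlongrightarrow> ?G s) (at_right s)"
  proof cases
    case 1
    have "\<forall>\<^sub>F t in at_right s. ?G t = 0"
      using 1 unfolding eventually_at_right_field by (auto simp: extended_path_def intro!: exI[of _ 0])
    then show ?thesis using 1 by (simp add: extended_path_def tendsto_eventually)
  next
    case 2
    then have "(C \<longlongrightarrow> C (ereal s)) (at_right (ereal s))"
      using C by (simp add: stieltjes_path_def right_continuous_path_def)
    then have lim: "((\<lambda>t. C (ereal t)) \<longlongrightarrow> C (ereal s)) (at_right s)"
      by (simp add: at_right_ereal filterlim_filtermap)
    obtain b where b: "s < b" "ereal b \<le> T"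
    proof (cases T)
      case (real r) then show ?thesis using that[of r] 2 by auto
    next
      case PInf then show ?thesis using that[of "s + 1"] by auto
    qed (use 2 in auto)
    have "\<forall>\<^sub>F t in at_right s. t < b \<and> s < t"
      using b by (auto simp: eventually_at_right_field)
    then have "\<forall>\<^sub>F t in at_right s. C (ereal t) = ?G t"
    proof eventually_elim
      case (elim t)
      then have "ereal t \<le> T" using b by (meson ereal_less_eq(3) less_imp_le order_trans)
      then show ?case using elim 2 by (simp add: extended_path_def min_def)
    qed
    moreover have "?G s = C (ereal s)" using 2 less_imp_le[OF 2(2)] by (simp add: extended_path_def min_def)
    ultimately show ?thesis using lim by (simp add: tendsto_cong)
  next
    case 3
    have "\<forall>\<^sub>F t in at_right s. ?G t = C T"
      using eventually_at_right_less[of s]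
    proof eventually_elim
      case (elim t)
      then have "T \<le> ereal t" using 3 by (meson ereal_less_eq(3) less_imp_le order_trans)
      then show ?case using elim 3 by (simp add: extended_path_def min_def)
    qed
    moreover have "?G s = C T" using 3 by (simp add: extended_path_def min_def)
    ultimately show ?thesis by (simp add: tendsto_eventually)
  qed
  then show ?thesis by (simp add: continuous_within)
qed

lemma emeasure_extended_path_Ioc:
  "emeasure (interval_measure (extended_path T C)) {a<..b}
    = (if a \<le> b then ennreal (extended_path T C b - extended_path T C a) else 0)"
  using emeasure_interval_measure_Ioc[of a b "extended_path T C"]
  by (auto simp: extended_path_mono extended_path_right_continuous)

text \<open>Both measures agree on half-open intervals, a generator stable under intersection, and
  are finite on an exhausting sequence of them.\<close>

lemma interval_measure_scale:
  assumes a: "0 \<le> a"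
  shows "interval_measure (extended_path T (\<lambda>t. a * C t))
    = scale_measure (ennreal a) (interval_measure (extended_path T C))" (is "?M = ?N")
proof (rule measure_eqI_generator_eq)
  let ?E = "range (\<lambda>(a, b). {a<..b::real})"
  show "Int_stable ?E" by (auto simp: Int_stable_def)
  show "sets ?M = sigma_sets UNIV ?E" "sets ?N = sigma_sets UNIV ?E"
    by (simp_all add: borel_sigma_sets_Ioc)
  have scale: "extended_path T (\<lambda>t. a * C t) s = a * extended_path T C s" for s
    by (simp add: extended_path_def)
  have Ioc: "emeasure ?M {p<..q} = (if p \<le> q then ennreal (a * (extended_path T C q - extended_path T C p)) else 0)" for p q
    using emeasure_interval_measure_Ioc[of p q "extended_path T (\<lambda>t. a * C t)"] a
    by (auto simp: scale[abs_def] right_diff_distrib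
        intro!: mult_left_mono extended_path_mono continuous_mult_left extended_path_right_continuous)
  show "emeasure ?M X = emeasure ?N X" if "X \<in> ?E" for X
    using that a by (auto simp: Ioc emeasure_extended_path_Ioc ennreal_mult extended_path_mono)
  show "range (\<lambda>i::nat. {- real i<..real i}) \<subseteq> ?E" by auto
  show "(\<Union>i::nat. {- real i<..real i}) = UNIV"
  proof safe
    fix x :: real
    obtain i :: nat where "\<bar>x\<bar> < real i" using reals_Archimedean2 by blast
    then show "x \<in> (\<Union>i::nat. {- real i<..real i})" by (auto intro!: exI[of _ i])
  qed simp
  show "emeasure ?M {- real i<..real i} \<noteq> \<infinity>" for i by (simp add: Ioc)
qed auto

end

text \<open>The hypothesis removes the contribution of the point \<open>\<infinity>\<close>; the
  price \<open>\<psi>c\<close> satisfies it almost surely.\<close>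

lemma stieltjes_integral_eq:
  assumes "T = \<infinity> \<Longrightarrow> f \<infinity> = 0"
  shows "stieltjes_integral T f C =
    (\<integral>\<^sup>+s. indicator {s. 0 \<le> s \<and> ereal s \<le> T} s * ennreal (f (ereal s)) \<partial>interval_measure (extended_path T C))"
  using assms by (auto simp: stieltjes_integral_def extended_path_def mult.commute)

lemma stieltjes_integral_scale:
  assumes "0 < T" "stieltjes_path T C" "0 \<le> a" "T = \<infinity> \<Longrightarrow> f \<infinity> = 0"
    and [measurable]: "(\<lambda>s. indicator {s. 0 \<le> s \<and> ereal s \<le> T} s * f (ereal s)) \<in> borel_measurable borel"
  shows "stieltjes_integral T f (\<lambda>t. a * C t) = ennreal a * stieltjes_integral T f C"
proof -
  have "(\<lambda>s. ennreal (indicator {s. 0 \<le> s \<and> ereal s \<le> T} s * f (ereal s))) \<in> borel_measurable borel"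
    by measurable
  also have "(\<lambda>s. ennreal (indicator {s. 0 \<le> s \<and> ereal s \<le> T} s * f (ereal s)))
     = (\<lambda>s. indicator {s. 0 \<le> s \<and> ereal s \<le> T} s * ennreal (f (ereal s)))"
    by (auto simp: indicator_def)
  finally show ?thesis
    using assms by (simp add: stieltjes_integral_eq interval_measure_scale nn_integral_scale_measure
        measurable_cong_sets[OF sets_interval_measure refl])
qed

text \<open>A strictly positive integrand with zero integral forces the interval
  \<open>[0,T]\<close> to be null, including the atom \<open>C(0)\<close> at 0; hence
  \<open>C\<close> starts at 0 and never increases.\<close>

lemma stieltjes_integral_eq_0:
  assumes T: "0 < T" and C: "stieltjes_path T C" and f: "T = \<infinity> \<Longrightarrow> f \<infinity> = 0"
    and [measurable]: "(\<lambda>s. indicator {s. 0 \<le> s \<and> ereal s \<le> T} s * f (ereal s)) \<in> borel_measurable borel"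
    and pos: "\<And>s. 0 \<le> s \<Longrightarrow> ereal s \<le> T \<Longrightarrow> 0 < f (ereal s)"
    and 0: "stieltjes_integral T f C = 0"
  shows "terminal_value T C = 0"
proof -
  define S where "S = {s. 0 \<le> s \<and> ereal s \<le> T}"
  let ?G = "extended_path T C"
  have [measurable]: "S \<in> sets borel" by (simp add: S_def)
  have "(\<lambda>s. ennreal (indicator S s * f (ereal s))) \<in> borel_measurable borel"
    unfolding S_def by measurable
  moreover have "(\<integral>\<^sup>+s. ennreal (indicator S s * f (ereal s)) \<partial>interval_measure ?G) = 0"
  proof -
    have "(\<integral>\<^sup>+s. ennreal (indicator S s * f (ereal s)) \<partial>interval_measure ?G) = stieltjes_integral T f C"
      by (subst stieltjes_integral_eq[of T f, OF f])
         (auto simp: indicator_def S_def intro!: nn_integral_cong)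
    then show ?thesis by (simp add: 0)
  qed
  ultimately have "AE s in interval_measure ?G. ennreal (indicator S s * f (ereal s)) = 0"
    by (subst (asm) nn_integral_0_iff_AE) (auto simp: measurable_cong_sets[OF sets_interval_measure refl])
  then have "AE s in interval_measure ?G. s \<notin> S"
  proof eventually_elim
    case (elim s)
    then show ?case using pos[of s] by (auto simp: S_def indicator_def ennreal_eq_0_iff)
  qed
  then have S0: "emeasure (interval_measure ?G) S = 0"
    by (subst (asm) AE_iff_measurable[OF _ refl]) auto
  \<comment> \<open>The measure is known on half-open intervals only, and \<open>{- 1<..0}\<close>
    would already contain the atom at 0; so the open interval is exhausted from the left.\<close>
  have "emeasure (interval_measure ?G) (\<Union>i::nat. {- 1<..- (1 / real (Suc i))}) = 0"
    by (rule emeasure_UN_eq_0)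
       (auto simp: emeasure_extended_path_Ioc[OF T C], simp add: extended_path_def)
  also have "(\<Union>i::nat. {- 1<..- (1 / real (Suc i))}) = {- 1<..<0::real}"
  proof (intro equalityI subsetI)
    fix x :: real assume x: "x \<in> {- 1<..<0}"
    then obtain i where "inverse (real (Suc i)) < - x" using reals_Archimedean[of "- x"] by auto
    then show "x \<in> (\<Union>i::nat. {- 1<..- (1 / real (Suc i))})"
      using x by (auto simp: inverse_eq_divide intro!: exI[of _ i])
  next
    fix x :: real assume "x \<in> (\<Union>i::nat. {- 1<..- (1 / real (Suc i))})"
    then obtain i where "- 1 < x" "x \<le> - (1 / real (Suc i))" by auto
    moreover have "0 < 1 / real (Suc i)" by simp
    ultimately show "x \<in> {- 1<..<0}" unfolding greaterThanLessThan_iff by linarith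
  qed
  finally have neg: "emeasure (interval_measure ?G) {- 1<..<0} = 0" .
  have C0: "C (ereal t) = 0" if t: "0 \<le> t" "ereal t \<le> T" for t
  proof -
    \<comment> \<open>The mass of \<open>{- 1<..t}\<close> is \<open>C(t)\<close> itself, because
      the extended path vanishes at \<open>- 1\<close>.\<close>
    have "emeasure (interval_measure ?G) {- 1<..t} \<le> emeasure (interval_measure ?G) ({- 1<..<0} \<union> S)"
      using t by (intro emeasure_mono) (auto simp: S_def intro: order_trans[of _ "ereal t"])
    also have "\<dots> \<le> emeasure (interval_measure ?G) {- 1<..<0} + emeasure (interval_measure ?G) S"
      by (intro emeasure_subadditive) auto
    finally have "ennreal (?G t - ?G (- 1)) = 0"
      using t by (simp add: emeasure_extended_path_Ioc[OF T C] neg S0)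
    then have "C (ereal t) \<le> 0" using t by (simp add: extended_path_def min_def ennreal_eq_0_iff)
    moreover have "0 \<le> C (ereal t)" using C t by (simp add: stieltjes_path_def)
    ultimately show ?thesis by simp
  qed
  show ?thesis
  proof (cases T)
    case (real r)
    then show ?thesis using C0[of r] T by (simp add: terminal_value_def)
  next
    case PInf
    \<comment> \<open>Finite times suffice: \<open>terminal_value\<close> is the limit along them,
      whatever \<open>C \<infinity>\<close> is.\<close>
    have "C t = 0" if "t \<in> {0..<\<infinity>}" for t
      using that C0[of "real_of_ereal t"] PInf by (cases t) auto
    then show ?thesis using PInf by (auto simp: terminal_value_def image_constant_conv)
  qed (use T in auto)
qed

text \<open>The integrating measure depends on \<open>\<omega>\<close> and may be infinite, whereas
  the kernel lemmas are about subprobability measures. So it is cut to \<open>{- 1<..real N}\<close>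
  and normalised to a kernel \<open>K N\<close>; afterwards the normalisation is undone and
  \<open>N\<close> tends to infinity. As \<open>h\<close> vanishes at negative times, the cut on the
  left loses nothing.\<close>

lemma extended_path_kernel_measurable:
  fixes C :: "'a process" and h :: "'a \<Rightarrow> real \<Rightarrow> ennreal"
  assumes T: "0 < T"
    and C: "\<And>\<omega>. \<omega> \<in> space M \<Longrightarrow> stieltjes_path T (\<lambda>t. C t \<omega>)"
    and meas: "\<And>t. t \<in> {0..T} \<Longrightarrow> C t \<in> borel_measurable M"
    and h: "(\<lambda>(\<omega>, s). h \<omega> s) \<in> borel_measurable (M \<Otimes>\<^sub>M borel)"
    and h_neg: "\<And>\<omega> s. s < 0 \<Longrightarrow> h \<omega> s = 0"
  shows "(\<lambda>\<omega>. \<integral>\<^sup>+s. h \<omega> s \<partial>interval_measure (extended_path T (\<lambda>t. C t \<omega>))) \<in> borel_measurable M"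
proof -
  define G where "G \<omega> = extended_path T (\<lambda>t. C t \<omega>)" for \<omega>
  note Gmono = extended_path_mono[OF T C, folded G_def]
    and Gpos = extended_path_nonneg[OF T C, folded G_def]
    and GIoc = emeasure_extended_path_Ioc[OF T C, folded G_def]
  have Gm [measurable]: "(\<lambda>\<omega>. G \<omega> s) \<in> borel_measurable M" for s
    unfolding G_def extended_path_def using T by (cases "s < 0") (auto intro!: meas)
  have h1: "(\<lambda>s. h \<omega> s) \<in> borel_measurable borel" if "\<omega> \<in> space M" for \<omega>
    using measurable_compose[OF measurable_Pair1'[OF that] h] by simp
  \<comment> \<open>The total mass on the cut interval is \<open>G \<omega> (real N)\<close>.
    Dividing by one plus this mass gives total mass at most 1 and never divides by 0.\<close>
  define K where "K N \<omega> = density (interval_measure (G \<omega>))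
      (\<lambda>s. indicator {- 1<..real N} s * ennreal (1 / (1 + G \<omega> (real N))))" for N :: nat and \<omega>
  have setsK: "sets (K N \<omega>) = sets borel" for N \<omega> by (simp add: K_def)
  have emK: "emeasure (K N \<omega>) {..a} =
      (if - 1 \<le> min a (real N) then ennreal (G \<omega> (min a (real N))) else 0) * ennreal (1 / (1 + G \<omega> (real N)))"
    if "\<omega> \<in> space M" for \<omega> N a
  proof -
    have "emeasure (K N \<omega>) {..a} = (\<integral>\<^sup>+s. ennreal (1 / (1 + G \<omega> (real N))) * indicator {- 1<..min a (real N)} s
        \<partial>interval_measure (G \<omega>))"
      unfolding K_def
      by (subst emeasure_density) (auto simp: indicator_def measurable_cong_sets[OF sets_interval_measure refl] intro!: nn_integral_cong)
    also have "\<dots> = ennreal (1 / (1 + G \<omega> (real N))) * emeasure (interval_measure (G \<omega>)) {- 1<..min a (real N)}"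
      by (rule nn_integral_cmult_indicator) simp
    also have "\<dots> = (if - 1 \<le> min a (real N) then ennreal (G \<omega> (min a (real N))) else 0) * ennreal (1 / (1 + G \<omega> (real N)))"
      using that by (subst GIoc) (auto simp: G_def extended_path_def mult.commute)
    finally show ?thesis .
  qed
  have emKU: "emeasure (K N \<omega>) UNIV = ennreal (G \<omega> (real N)) * ennreal (1 / (1 + G \<omega> (real N)))"
    if "\<omega> \<in> space M" for \<omega> N
  proof -
    have "emeasure (K N \<omega>) UNIV = emeasure (K N \<omega>) {..real N}"
      unfolding K_def by (subst (1 2) emeasure_density)
        (auto simp: indicator_def measurable_cong_sets[OF sets_interval_measure refl] intro!: nn_integral_cong)
    then show ?thesis using emK[OF that, of N "real N"] by simp
  qed
  have K: "K N \<in> M \<rightarrow>\<^sub>M subprob_algebra borel" for N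
  proof (rule measurable_subprob_algebra_generated[where \<Omega>=UNIV and G="range (\<lambda>a. {..a::real})"])
    show "sets (borel :: real measure) = sigma_sets UNIV (range (\<lambda>a. {..a}))"
      by (subst borel_eq_atMost) simp
    show "Int_stable (range (\<lambda>a. {..a::real}))" by (auto simp: Int_stable_def)
    show "subprob_space (K N \<omega>)" if \<omega>: "\<omega> \<in> space M" for \<omega>
    proof
      have "emeasure (K N \<omega>) UNIV = ennreal (G \<omega> (real N) * (1 / (1 + G \<omega> (real N))))"
        using \<omega> Gpos[OF \<omega>, of "real N"] by (simp add: emKU ennreal_mult[symmetric])
      also have "\<dots> \<le> 1" using Gpos[OF \<omega>, of "real N"] by (intro ennreal_le_1[THEN iffD2]) simp
      finally show "emeasure (K N \<omega>) (space (K N \<omega>)) \<le> 1" by (simp add: K_def)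
      show "space (K N \<omega>) \<noteq> {}" by (simp add: K_def)
    qed
    show "(\<lambda>\<omega>. emeasure (K N \<omega>) A) \<in> borel_measurable M" if "A \<in> range (\<lambda>a. {..a::real})" for A
    proof -
      from that obtain a where A: "A = {..a}" by auto
      show ?thesis unfolding A
        by (subst measurable_cong[OF emK], assumption) measurable
    qed
    show "(\<lambda>\<omega>. emeasure (K N \<omega>) UNIV) \<in> borel_measurable M"
      by (subst measurable_cong[OF emKU], assumption) measurable
  qed (auto simp: setsK)
  have int: "(\<integral>\<^sup>+s. h \<omega> s * indicator {- 1<..real N} s \<partial>interval_measure (G \<omega>))
      = ennreal (1 + G \<omega> (real N)) * (\<integral>\<^sup>+s. h \<omega> s \<partial>K N \<omega>)" if \<omega>: "\<omega> \<in> space M" for \<omega> N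
  proof -
    let ?g = "1 + G \<omega> (real N)"
    have g: "0 < ?g" using Gpos[OF \<omega>, of "real N"] by simp
    have [measurable]: "h \<omega> \<in> borel_measurable (interval_measure (G \<omega>))"
      using h1[OF \<omega>] by (simp add: measurable_cong_sets[OF sets_interval_measure refl])
    have "(\<integral>\<^sup>+s. h \<omega> s \<partial>K N \<omega>)
      = (\<integral>\<^sup>+s. ennreal (1 / ?g) * (h \<omega> s * indicator {- 1<..real N} s) \<partial>interval_measure (G \<omega>))"
      unfolding K_def by (subst nn_integral_density) (auto simp: mult_ac)
    also have "\<dots> = ennreal (1 / ?g) * (\<integral>\<^sup>+s. h \<omega> s * indicator {- 1<..real N} s \<partial>interval_measure (G \<omega>))"
      by (rule nn_integral_cmult) measurable
    finally show ?thesis using g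
      by (simp add: mult.assoc[symmetric] ennreal_mult[symmetric])
  qed
  have intm: "(\<lambda>\<omega>. \<integral>\<^sup>+s. h \<omega> s * indicator {- 1<..real N} s \<partial>interval_measure (G \<omega>)) \<in> borel_measurable M" for N
    by (subst measurable_cong[OF int], assumption)
       (intro borel_measurable_times_ennreal nn_integral_measurable_subprob_algebra2[OF h K], measurable)
  have "(\<integral>\<^sup>+s. h \<omega> s \<partial>interval_measure (G \<omega>))
      = (SUP N. \<integral>\<^sup>+s. h \<omega> s * indicator {- 1<..real N} s \<partial>interval_measure (G \<omega>))" if \<omega>: "\<omega> \<in> space M" for \<omega>
  proof -
    have [measurable]: "h \<omega> \<in> borel_measurable (interval_measure (G \<omega>))"
      using h1[OF \<omega>] by (simp add: measurable_cong_sets[OF sets_interval_measure refl])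
    have "(\<integral>\<^sup>+s. h \<omega> s \<partial>interval_measure (G \<omega>))
      = (\<integral>\<^sup>+s. (SUP N. h \<omega> s * indicator {- 1<..real N} s) \<partial>interval_measure (G \<omega>))"
    proof (intro nn_integral_cong)
      fix s
      obtain N :: nat where N: "s \<le> real N" using real_arch_simple by blast
      show "h \<omega> s = (SUP N. h \<omega> s * indicator {- 1<..real N} s)"
      proof (cases "s < 0")
        case True then show ?thesis by (simp add: h_neg)
      next
        case False
        show ?thesis
        proof (rule antisym)
          show "h \<omega> s \<le> (SUP N. h \<omega> s * indicator {- 1<..real N} s)"
            by (rule SUP_upper2[of N]) (use N False in auto)
        qed (auto intro!: SUP_least simp: indicator_def)
      qed
    qed
    also have "\<dots> = (SUP N. \<integral>\<^sup>+s. h \<omega> s * indicator {- 1<..real N} s \<partial>interval_measure (G \<omega>))"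
      by (intro nn_integral_monotone_convergence_SUP)
         (auto simp: incseq_def le_fun_def indicator_def)
    finally show ?thesis .
  qed
  then show ?thesis
    unfolding G_def[symmetric]
    by (subst measurable_cong[where g="\<lambda>\<omega>. SUP N. \<integral>\<^sup>+s. h \<omega> s * indicator {- 1<..real N} s \<partial>interval_measure (G \<omega>)"])
       (auto intro!: borel_measurable_SUP intm)
qed

section \<open>Costs\<close>

definition joint :: "'a process \<Rightarrow> 'a \<times> real \<Rightarrow> real" where
  "joint X z = X (ereal (snd z)) (fst z)"

definition consumption_cost :: "'a measure \<Rightarrow> ereal \<Rightarrow> 'a process \<Rightarrow> 'a process \<Rightarrow> ennreal" where
  "consumption_cost M T \<psi> x = (\<integral>\<^sup>+z. ennreal (joint \<psi> z * joint x z) \<partial>(M \<Otimes>\<^sub>M dt T))"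

definition contribution_cost :: "'a measure \<Rightarrow> ereal \<Rightarrow> 'a process \<Rightarrow> 'a process \<Rightarrow> ennreal" where
  "contribution_cost M T \<psi> C = (\<integral>\<^sup>+\<omega>. stieltjes_integral T (\<lambda>t. \<psi> t \<omega>) (\<lambda>t. C t \<omega>) \<partial>M)"

definition nonneg_process :: "'a measure \<Rightarrow> ereal \<Rightarrow> 'a process \<Rightarrow> bool" where
  "nonneg_process M T x \<longleftrightarrow> (\<forall>t\<in>{0..T}. \<forall>\<omega>\<in>space M. 0 \<le> x t \<omega>)"

lemma optional_process_iff:
  "optional_process M F T X \<longleftrightarrow> (\<lambda>z. X (snd z) (fst z)) \<in> borel_measurable (optional_algebra M F T)"
  by (simp add: optional_process_def case_prod_unfold)

lemma joint_nonneg: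
  "nonneg_process M T x \<Longrightarrow> z \<in> space (M \<Otimes>\<^sub>M dt T) \<Longrightarrow> 0 \<le> joint x z"
  by (auto simp: joint_def nonneg_process_def space_pair_measure space_dt)

section \<open>Measurability, linearity and bounds of costs\<close>

context usual_filtered_prob_space
begin

lemma joint_measurable: "optional_process M F T x \<Longrightarrow> joint x \<in> borel_measurable (M \<Otimes>\<^sub>M dt T)"
  using optional_measurable_dt[of x] by (simp add: joint_def[abs_def])

lemma price_measurable_borel:
  assumes "price_process M F T \<psi>"
  shows "(\<lambda>(\<omega>, s). indicator {s. 0 \<le> s \<and> ereal s \<le> T} s * \<psi> (ereal s) \<omega>) \<in> borel_measurable (M \<Otimes>\<^sub>M borel)"
  using assms by (intro right_continuous_measurable_borel horizon_pos adapted_measurable)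
    (auto simp: price_process_def)

lemma price_measurable:
  assumes "price_process M F T \<psi>"
  shows "joint \<psi> \<in> borel_measurable (M \<Otimes>\<^sub>M dt T)"
  unfolding joint_def[abs_def]
  using assms by (intro right_continuous_measurable_dt horizon_pos adapted_measurable)
    (auto simp: price_process_def)

lemma price_pos:
  "price_process M F T \<psi> \<Longrightarrow> z \<in> space (M \<Otimes>\<^sub>M dt T) \<Longrightarrow> 0 < joint \<psi> z"
  by (auto simp: price_process_def joint_def space_pair_measure space_dt finite_times_def)

lemma price_path_measurable:
  assumes "price_process M F T \<psi>" "\<omega> \<in> space M"
  shows "(\<lambda>s. indicator {s. 0 \<le> s \<and> ereal s \<le> T} s * \<psi> (ereal s) \<omega>) \<in> borel_measurable borel"
  using measurable_compose[OF measurable_Pair1'[OF assms(2)] price_measurable_borel[OF assms(1)]] by simp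

lemma admissible_stieltjes_path:
  "admissible M F T x C \<Longrightarrow> AE \<omega> in M. stieltjes_path T (\<lambda>t. C t \<omega>)"
proof -
  assume C: "admissible M F T x C"
  then have "AE \<omega> in M. right_continuous_path T (\<lambda>t. C t \<omega>) \<and> mono_on {0..T} (\<lambda>t. C t \<omega>)"
    by (simp add: admissible_def)
  with AE_space show ?thesis
    by eventually_elim (use C in \<open>auto simp: admissible_def stieltjes_path_def\<close>)
qed

text \<open>On the null set where the path is irregular or the price at \<open>\<infinity>\<close>
  is nonzero, the path is replaced by 0. The kernel lemma then applies for every
  \<open>\<omega>\<close>, and completeness transfers the result back.\<close>

lemma stieltjes_integral_measurable:
  assumes \<psi>: "price_process M F T \<psi>" and inf: "T = \<infinity> \<longrightarrow> (AE \<omega> in M. \<psi> T \<omega> = 0)"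
    and C: "admissible M F T x C"
  shows "(\<lambda>\<omega>. stieltjes_integral T (\<lambda>t. \<psi> t \<omega>) (\<lambda>t. C t \<omega>)) \<in> borel_measurable M"
proof -
  have "AE \<omega> in M. stieltjes_path T (\<lambda>t. C t \<omega>) \<and> (T = \<infinity> \<longrightarrow> \<psi> \<infinity> \<omega> = 0)"
    using admissible_stieltjes_path[OF C] inf by (cases "T = \<infinity>") auto
  then obtain N where N: "N \<in> null_sets M"
    and N': "\<And>\<omega>. \<omega> \<in> space M - N \<Longrightarrow> stieltjes_path T (\<lambda>t. C t \<omega>) \<and> (T = \<infinity> \<longrightarrow> \<psi> \<infinity> \<omega> = 0)"
    by (elim AE_E3) blast
  define C' where "C' t \<omega> = (if \<omega> \<in> N then 0 else C t \<omega>)" for t \<omega>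
  define h where "h \<omega> s = ennreal (indicator {s. 0 \<le> s \<and> ereal s \<le> T} s * \<psi> (ereal s) \<omega>)" for \<omega> s
  show ?thesis
  proof (rule borel_measurable_AE_eq)
    show "(\<lambda>\<omega>. \<integral>\<^sup>+s. h \<omega> s \<partial>interval_measure (extended_path T (\<lambda>t. C' t \<omega>))) \<in> borel_measurable M"
    proof (rule extended_path_kernel_measurable[OF horizon_pos])
      show "stieltjes_path T (\<lambda>t. C' t \<omega>)" if "\<omega> \<in> space M" for \<omega>
        using N'[of \<omega>] that
        by (cases "\<omega> \<in> N") (auto simp: C'_def stieltjes_path_def right_continuous_path_def mono_on_def)
      show "C' t \<in> borel_measurable M" if t: "t \<in> {0..T}" for t
      proof -
        have [measurable]: "C t \<in> borel_measurable M" "N \<in> sets M"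
          using optional_measurable[OF _ t] C N by (auto simp: admissible_def)
        show ?thesis unfolding C'_def by measurable
      qed
      show "(\<lambda>(\<omega>, s). h \<omega> s) \<in> borel_measurable (M \<Otimes>\<^sub>M borel)"
        unfolding h_def using price_measurable_borel[OF \<psi>] by (simp add: case_prod_unfold)
    qed (simp add: h_def)
    show "AE \<omega> in M. stieltjes_integral T (\<lambda>t. \<psi> t \<omega>) (\<lambda>t. C t \<omega>)
      = (\<integral>\<^sup>+s. h \<omega> s \<partial>interval_measure (extended_path T (\<lambda>t. C' t \<omega>)))"
      using AE_not_in[OF N] AE_space
    proof eventually_elim
      case (elim \<omega>)
      then have "(\<lambda>t. C' t \<omega>) = (\<lambda>t. C t \<omega>)" by (simp add: C'_def)
      moreover have "stieltjes_integral T (\<lambda>t. \<psi> t \<omega>) (\<lambda>t. C t \<omega>) =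
        (\<integral>\<^sup>+s. indicator {s. 0 \<le> s \<and> ereal s \<le> T} s * ennreal (\<psi> (ereal s) \<omega>)
          \<partial>interval_measure (extended_path T (\<lambda>t. C t \<omega>)))"
        using N'[of \<omega>] elim by (intro stieltjes_integral_eq) auto
      ultimately show ?case
        by (auto simp: h_def indicator_def intro!: nn_integral_cong)
    qed
  qed
qed

lemma nn_integral_joint:
  assumes "f \<in> borel_measurable (M \<Otimes>\<^sub>M dt T)"
  shows "(\<integral>\<^sup>+\<omega>. \<integral>\<^sup>+s. f (\<omega>, s) \<partial>dt T \<partial>M) = (\<integral>\<^sup>+z. f z \<partial>(M \<Otimes>\<^sub>M dt T))"
  by (rule sigma_finite_measure.nn_integral_fst[OF sigma_finite_dt assms])

lemma expenditure_split:
  assumes \<psi>x: "price_process M F T \<psi>x"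
    and \<psi>c: "price_process M F T \<psi>c" "T = \<infinity> \<longrightarrow> (AE \<omega> in M. \<psi>c T \<omega> = 0)"
    and C: "admissible M F T x C"
  shows "expenditure M T \<psi>x \<psi>c x C = consumption_cost M T \<psi>x x + contribution_cost M T \<psi>c C"
proof -
  define f where "f z = ennreal (joint \<psi>x z * joint x z)" for z
  have [measurable]: "joint x \<in> borel_measurable (M \<Otimes>\<^sub>M dt T)"
    using C by (intro joint_measurable) (auto simp: admissible_def)
  note [measurable] = price_measurable[OF \<psi>x]
  have f: "f \<in> borel_measurable (M \<Otimes>\<^sub>M dt T)" unfolding f_def by measurable
  have "expenditure M T \<psi>x \<psi>c x C
    = (\<integral>\<^sup>+\<omega>. (\<integral>\<^sup>+s. f (\<omega>, s) \<partial>dt T) + stieltjes_integral T (\<lambda>t. \<psi>c t \<omega>) (\<lambda>t. C t \<omega>) \<partial>M)"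
    by (simp add: expenditure_def f_def joint_def)
  also have "\<dots> = (\<integral>\<^sup>+\<omega>. \<integral>\<^sup>+s. f (\<omega>, s) \<partial>dt T \<partial>M) + contribution_cost M T \<psi>c C"
    unfolding contribution_cost_def
    by (intro nn_integral_add stieltjes_integral_measurable[OF \<psi>c C]
        sigma_finite_measure.borel_measurable_nn_integral_fst[OF sigma_finite_dt f])
  also have "(\<integral>\<^sup>+\<omega>. \<integral>\<^sup>+s. f (\<omega>, s) \<partial>dt T \<partial>M) = consumption_cost M T \<psi>x x"
    unfolding nn_integral_joint[OF f] by (auto simp: consumption_cost_def f_def intro!: nn_integral_cong)
  finally show ?thesis .
qed

lemma contribution_cost_scale:
  assumes \<psi>: "price_process M F T \<psi>" "T = \<infinity> \<longrightarrow> (AE \<omega> in M. \<psi> T \<omega> = 0)"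
    and C: "admissible M F T x C" and a: "0 \<le> a"
  shows "contribution_cost M T \<psi> (\<lambda>t \<omega>. a * C t \<omega>) = ennreal a * contribution_cost M T \<psi> C"
proof -
  have "AE \<omega> in M. T = \<infinity> \<longrightarrow> \<psi> \<infinity> \<omega> = 0" using \<psi>(2) by (cases "T = \<infinity>") auto
  then have "AE \<omega> in M. stieltjes_integral T (\<lambda>t. \<psi> t \<omega>) (\<lambda>t. a * C t \<omega>)
    = ennreal a * stieltjes_integral T (\<lambda>t. \<psi> t \<omega>) (\<lambda>t. C t \<omega>)"
    using admissible_stieltjes_path[OF C] AE_space
    by eventually_elim (auto intro!: stieltjes_integral_scale horizon_pos a price_path_measurable[OF \<psi>(1)])
  then show ?thesis
    unfolding contribution_cost_def
    by (subst nn_integral_cmult[OF stieltjes_integral_measurable[OF \<psi> C], symmetric])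
       (rule nn_integral_cong_AE)
qed

text \<open>Read contrapositively, this turns a positive expected terminal contribution into a
  positive cost.\<close>

lemma contribution_cost_eq_0:
  assumes \<psi>: "price_process M F T \<psi>" "T = \<infinity> \<longrightarrow> (AE \<omega> in M. \<psi> T \<omega> = 0)"
    and C: "admissible M F T x C" and 0: "contribution_cost M T \<psi> C = 0"
  shows "(\<integral>\<^sup>+\<omega>. terminal_value T (\<lambda>t. C t \<omega>) \<partial>M) = 0"
proof -
  have "AE \<omega> in M. T = \<infinity> \<longrightarrow> \<psi> \<infinity> \<omega> = 0" using \<psi>(2) by (cases "T = \<infinity>") auto
  moreover have "AE \<omega> in M. stieltjes_integral T (\<lambda>t. \<psi> t \<omega>) (\<lambda>t. C t \<omega>) = 0"
    using 0 nn_integral_0_iff_AE[OF stieltjes_integral_measurable[OF \<psi> C]]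
    by (simp add: contribution_cost_def)
  ultimately have "AE \<omega> in M. terminal_value T (\<lambda>t. C t \<omega>) = 0"
    using admissible_stieltjes_path[OF C] AE_space
  proof eventually_elim
    case (elim \<omega>)
    show ?case
      by (rule stieltjes_integral_eq_0[OF horizon_pos _ _ price_path_measurable[OF \<psi>(1)], of _ \<omega>])
         (use elim \<psi>(1) in \<open>auto simp: price_process_def finite_times_def\<close>)
  qed
  then have "(\<integral>\<^sup>+\<omega>. terminal_value T (\<lambda>t. C t \<omega>) \<partial>M) = (\<integral>\<^sup>+\<omega>. 0 \<partial>M)"
    by (rule nn_integral_cong_AE)
  then show ?thesis by simp
qed

lemma consumption_cost_linear:
  assumes \<psi>: "price_process M F T \<psi>"
    and x: "optional_process M F T x" "nonneg_process M T x"
    and y: "optional_process M F T y" "nonneg_process M T y"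
    and a: "0 \<le> a" "0 \<le> c"
  shows "consumption_cost M T \<psi> (\<lambda>t \<omega>. a * x t \<omega> + c * y t \<omega>)
    = ennreal a * consumption_cost M T \<psi> x + ennreal c * consumption_cost M T \<psi> y"
proof -
  note [measurable] = price_measurable[OF \<psi>] joint_measurable[OF x(1)] joint_measurable[OF y(1)]
  have "consumption_cost M T \<psi> (\<lambda>t \<omega>. a * x t \<omega> + c * y t \<omega>)
    = (\<integral>\<^sup>+z. ennreal a * ennreal (joint \<psi> z * joint x z) + ennreal c * ennreal (joint \<psi> z * joint y z) \<partial>(M \<Otimes>\<^sub>M dt T))"
    unfolding consumption_cost_def
  proof (rule nn_integral_cong)
    fix z assume z: "z \<in> space (M \<Otimes>\<^sub>M dt T)"
    have "joint \<psi> z * joint (\<lambda>t \<omega>. a * x t \<omega> + c * y t \<omega>) z = a * (joint \<psi> z * joint x z) + c * (joint \<psi> z * joint y z)"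
      by (simp add: joint_def algebra_simps)
    then show "ennreal (joint \<psi> z * joint (\<lambda>t \<omega>. a * x t \<omega> + c * y t \<omega>) z)
      = ennreal a * ennreal (joint \<psi> z * joint x z) + ennreal c * ennreal (joint \<psi> z * joint y z)"
      using a price_pos[OF \<psi> z] joint_nonneg[OF x(2) z] joint_nonneg[OF y(2) z]
      by (simp add: ennreal_plus ennreal_mult)
  qed
  also have "\<dots> = ennreal a * consumption_cost M T \<psi> x + ennreal c * consumption_cost M T \<psi> y"
    unfolding consumption_cost_def by (subst nn_integral_add) (auto simp: nn_integral_cmult)
  finally show ?thesis .
qed

lemma consumption_cost_mono:
  assumes \<psi>: "price_process M F T \<psi>"
    and "\<And>z. z \<in> space (M \<Otimes>\<^sub>M dt T) \<Longrightarrow> joint x z \<le> joint y z"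
  shows "consumption_cost M T \<psi> x \<le> consumption_cost M T \<psi> y"
  unfolding consumption_cost_def
  using assms by (intro nn_integral_mono ennreal_leI mult_left_mono) (auto intro: less_imp_le price_pos)

definition decay :: "real \<Rightarrow> 'a process" where
  "decay a = (\<lambda>t \<omega>. if t = \<infinity> then 0 else a * exp (- real_of_ereal t))"

text \<open>A price is a discount factor at most 1, because its rate is positive, times a process of
  mean one. So its mean is at most 1 at each finite time, and the integral of
  \<open>a * exp (- s)\<close> over the half-line is \<open>a\<close>.\<close>

lemma consumption_cost_decay:
  assumes \<psi>: "price_process M F T \<psi>" and a: "0 \<le> a"
  shows "consumption_cost M T \<psi> (decay a) \<le> ennreal a"
proof -
  note [measurable] = price_measurable[OF \<psi>]
  obtain \<rho> \<E> where \<rho>: "bounded_positive M T \<rho>" and \<E>: "exponential_martingale M F T \<E>"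
    and eq: "\<And>s. ereal s \<in> finite_times T \<Longrightarrow> AE \<omega> in M. \<psi> (ereal s) \<omega> = discount \<rho> s \<omega> * \<E> (ereal s) \<omega>"
    using \<psi> unfolding price_process_def by auto
  have E1: "(\<integral>\<^sup>+\<omega>. ennreal (\<psi> (ereal s) \<omega>) \<partial>M) \<le> 1" if s: "0 \<le> s" "ereal s \<le> T" for s
  proof -
    have fs: "ereal s \<in> finite_times T" using s by (simp add: finite_times_def)
    have E: "integrable M (\<E> (ereal s))" "(LINT \<omega>|M. \<E> (ereal s) \<omega>) = 1" "\<And>\<omega>. \<omega> \<in> space M \<Longrightarrow> 0 < \<E> (ereal s) \<omega>"
      using \<E> fs by (auto simp: exponential_martingale_def martingale_on_def)
    have "(\<integral>\<^sup>+\<omega>. ennreal (\<psi> (ereal s) \<omega>) \<partial>M) \<le> (\<integral>\<^sup>+\<omega>. ennreal (\<E> (ereal s) \<omega>) \<partial>M)"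
    proof (rule nn_integral_mono_AE)
      show "AE \<omega> in M. ennreal (\<psi> (ereal s) \<omega>) \<le> ennreal (\<E> (ereal s) \<omega>)"
        using eq[OF fs] AE_space
      proof eventually_elim
        case (elim \<omega>)
        have "0 \<le> (LINT v:{0..s}|lborel. \<rho> (ereal v) \<omega>)"
          unfolding set_lebesgue_integral_def
        proof (rule integral_nonneg_AE, rule AE_I2)
          fix v
          have "0 < \<rho> (ereal v) \<omega>" if "v \<in> {0..s}"
            using \<rho> elim(2) that s order_trans[of "ereal v" "ereal s" T] by (auto simp: bounded_positive_def)
          then show "0 \<le> indicat_real {0..s} v *\<^sub>R \<rho> (ereal v) \<omega>" by (auto simp: indicator_def)
        qed
        then have "discount \<rho> s \<omega> \<le> 1" by (simp add: discount_def)
        then show ?case using elim E(3)[of \<omega>] by (auto intro!: ennreal_leI mult_left_le_one_le simp: discount_def)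
      qed
    qed
    also have "\<dots> = ennreal (LINT \<omega>|M. \<E> (ereal s) \<omega>)"
      using E by (intro nn_integral_eq_integral) (auto intro: less_imp_le)
    finally show ?thesis using E(2) by simp
  qed
  have pair: "pair_sigma_finite M (dt T)"
    by (intro pair_sigma_finite.intro sigma_finite_dt sigma_finite_measure_axioms)
  have [measurable]: "(\<lambda>z. joint (decay a) z) \<in> borel_measurable (M \<Otimes>\<^sub>M dt T)"
    using optional_exp_decay[of a] by (intro joint_measurable) (simp add: decay_def)
  \<comment> \<open>Tonelli: the expectation is taken first, since the price is controlled only in
    mean at a fixed time.\<close>
  have "consumption_cost M T \<psi> (decay a)
    = (\<integral>\<^sup>+s. \<integral>\<^sup>+\<omega>. ennreal (joint \<psi> (\<omega>, s) * joint (decay a) (\<omega>, s)) \<partial>M \<partial>dt T)"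
    unfolding consumption_cost_def
    by (rule pair_sigma_finite.nn_integral_snd[OF pair, symmetric]) measurable
  also have "\<dots> \<le> (\<integral>\<^sup>+s. ennreal (a * exp (- s)) \<partial>dt T)"
  proof (rule nn_integral_mono)
    fix s assume "s \<in> space (dt T)"
    then have s: "0 \<le> s" "ereal s \<le> T" by (auto simp: space_dt)
    have [measurable]: "\<psi> (ereal s) \<in> borel_measurable M"
      using \<psi> s by (intro adapted_measurable) (auto simp: price_process_def)
    have "(\<integral>\<^sup>+\<omega>. ennreal (joint \<psi> (\<omega>, s) * joint (decay a) (\<omega>, s)) \<partial>M)
      = (\<integral>\<^sup>+\<omega>. ennreal (a * exp (- s)) * ennreal (\<psi> (ereal s) \<omega>) \<partial>M)"
      using mult_nonneg_nonneg[OF a exp_ge_zero, of "- s"]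
      by (intro nn_integral_cong) (auto simp: joint_def decay_def ennreal_mult'' intro: mult.commute)
    also have "\<dots> = ennreal (a * exp (- s)) * (\<integral>\<^sup>+\<omega>. ennreal (\<psi> (ereal s) \<omega>) \<partial>M)"
      by (rule nn_integral_cmult) measurable
    also have "\<dots> \<le> ennreal (a * exp (- s)) * 1" by (intro mult_left_mono E1 s) simp
    finally show "(\<integral>\<^sup>+\<omega>. ennreal (joint \<psi> (\<omega>, s) * joint (decay a) (\<omega>, s)) \<partial>M) \<le> ennreal (a * exp (- s))" by simp
  qed
  also have "\<dots> \<le> (\<integral>\<^sup>+s. ennreal (a * exp (- s)) * indicator {0..} s \<partial>lborel)"
    unfolding nn_integral_dt by (intro nn_integral_mono) (auto simp: indicator_def)
  also have "\<dots> = ennreal (0 - (- a * exp (- 0)))"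
  proof (rule nn_integral_FTC_atLeast)
    show "((\<lambda>s. - a * exp (- s)) \<longlongrightarrow> 0) at_top"
      by (rule tendsto_mult_right_zero)
         (intro filterlim_compose[OF exp_at_bot] filterlim_uminus_at_bot_at_top)
  qed (use a in \<open>auto intro!: derivative_eq_intros\<close>)
  finally show ?thesis by simp
qed

lemma in_budget_set_iff:
  assumes "price_process M F T \<psi>x" "price_process M F T \<psi>c" "T = \<infinity> \<longrightarrow> (AE \<omega> in M. \<psi>c T \<omega> = 0)"
  shows "(x, C) \<in> budget_set M F T \<psi>x \<psi>c b \<longleftrightarrow>
    admissible M F T x C \<and> consumption_cost M T \<psi>x x + contribution_cost M T \<psi>c C \<le> ennreal b"
  using expenditure_split[OF assms] by (auto simp: budget_set_def)

lemma admissible_scale: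
  assumes y: "optional_process M F T y" "nonneg_process M T y"
    and C: "admissible M F T x C" and a: "0 \<le> a"
  shows "admissible M F T y (\<lambda>t \<omega>. a * C t \<omega>)"
  unfolding admissible_def
proof (intro conjI)
  show "optional_process M F T (\<lambda>t \<omega>. a * C t \<omega>)"
    using C by (auto simp: admissible_def optional_process_iff)
  show "\<forall>t\<in>{0..T}. \<forall>\<omega>\<in>space M. 0 \<le> y t \<omega> \<and> 0 \<le> a * C t \<omega>"
    using C y(2) a by (auto simp: admissible_def nonneg_process_def)
  show "AE \<omega> in M. right_continuous_path T (\<lambda>t. a * C t \<omega>) \<and> mono_on {0..T} (\<lambda>t. a * C t \<omega>)"
    using admissible_stieltjes_path[OF C]
    by eventually_elim (use stieltjes_path_scale[OF _ a] in \<open>auto simp: stieltjes_path_def\<close>)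
qed (rule y)

text \<open>Every deviation below has this form: a freely built consumption together with a constant
  multiple of an existing contribution.\<close>

lemma budget_setI:
  assumes \<psi>: "price_process M F T \<psi>x" "price_process M F T \<psi>c" "T = \<infinity> \<longrightarrow> (AE \<omega> in M. \<psi>c T \<omega> = 0)"
    and y: "optional_process M F T y" "nonneg_process M T y"
    and C: "admissible M F T x C" and a: "0 \<le> a"
    and cost: "consumption_cost M T \<psi>x y + ennreal a * contribution_cost M T \<psi>c C \<le> ennreal b"
  shows "(y, \<lambda>t \<omega>. a * C t \<omega>) \<in> budget_set M F T \<psi>x \<psi>c b"
  using cost admissible_scale[OF y C a]
  by (simp add: in_budget_set_iff[OF \<psi>] contribution_cost_scale[OF \<psi>(2,3) C a])

end

section \<open>Integral comparison\<close>

lemma integral_le_imp_AE_eq: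
  fixes f g :: "'b \<Rightarrow> real"
  assumes [measurable]: "integrable N f" "integrable N g"
    and le: "AE z in N. f z \<le> g z" and int: "(LINT z|N. g z) \<le> (LINT z|N. f z)"
  shows "AE z in N. f z = g z"
proof -
  have "(LINT z|N. g z - f z) = 0"
    using int integral_mono_AE[OF assms(1,2) le] by (simp add: assms(1,2))
  moreover have "AE z in N. 0 \<le> g z - f z" using le by eventually_elim simp
  ultimately have "AE z in N. g z - f z = 0"
    using integral_nonneg_eq_0_iff_AE[of N "\<lambda>z. g z - f z"] assms(1,2) by auto
  then show ?thesis by eventually_elim simp
qed

context
  fixes N :: "'b measure" and g :: "nat \<Rightarrow> 'b \<Rightarrow> real" and f :: "'b \<Rightarrow> real"
  assumes g: "\<And>m. integrable N (g m)" and f: "integrable N f"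
    and int: "\<And>m. (LINT z|N. g m z) \<le> 0"
    and lower: "\<And>m. AE z in N. - f z \<le> g m z"
begin

text \<open>Fatou's lemma for \<open>g m + f\<close>, which is nonnegative almost everywhere. In the
  applications \<open>g m\<close> is a difference quotient of payoffs, whose integral is at most 0
  because the deviation does not pay.\<close>

lemma nn_integral_liminf_quotients:
  "(\<integral>\<^sup>+z. liminf (\<lambda>m. ennreal (g m z + f z)) \<partial>N) \<le> ennreal (LINT z|N. f z)"
proof -
  have [measurable]: "g m \<in> borel_measurable N" "f \<in> borel_measurable N" for m
    using g f by auto
  have "(\<integral>\<^sup>+z. liminf (\<lambda>m. ennreal (g m z + f z)) \<partial>N) \<le> liminf (\<lambda>m. \<integral>\<^sup>+z. ennreal (g m z + f z) \<partial>N)"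
    by (rule nn_integral_liminf) measurable
  also have "\<dots> \<le> liminf (\<lambda>m. ennreal (LINT z|N. f z))"
  proof (intro Liminf_mono always_eventually allI)
    fix m
    have "(\<integral>\<^sup>+z. ennreal (g m z + f z) \<partial>N) = ennreal (LINT z|N. g m z + f z)"
    proof (rule nn_integral_eq_integral)
      show "AE z in N. 0 \<le> g m z + f z" using lower[of m] by eventually_elim simp
    qed (use g f in simp)
    also have "\<dots> \<le> ennreal (LINT z|N. f z)" using int[of m] g f by (intro ennreal_leI) simp
    finally show "(\<integral>\<^sup>+z. ennreal (g m z + f z) \<partial>N) \<le> ennreal (LINT z|N. f z)" .
  qed
  finally show ?thesis by (simp add: Liminf_const)
qed

text \<open>The liminf has a finite integral, hence is finite almost everywhere, which excludes
  points with exploding quotients.\<close>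

lemma AE_not_quotients_at_top:
  assumes "AE z in N. P z \<longrightarrow> filterlim (\<lambda>m. g m z) at_top sequentially"
  shows "AE z in N. \<not> P z"
proof -
  have [measurable]: "g m \<in> borel_measurable N" "f \<in> borel_measurable N" for m
    using g f by auto
  have "AE z in N. liminf (\<lambda>m. ennreal (g m z + f z)) \<noteq> \<infinity>"
    using nn_integral_liminf_quotients
    by (intro nn_integral_PInf_AE) (auto simp: top_unique, measurable)
  with assms show ?thesis
  proof eventually_elim
    case (elim z)
    show ?case
    proof
      assume "P z"
      then have "filterlim (\<lambda>m. f z + g m z) at_top sequentially"
        using elim by (intro filterlim_tendsto_add_at_top[OF tendsto_const]) auto
      then have "(\<lambda>m. ennreal (g m z + f z)) \<longlonglongrightarrow> \<infinity>"
        by (simp add: ennreal_tendsto_top_eq_at_top add.commute)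
      then show False using elim lim_imp_Liminf[of sequentially] by force
    qed
  qed
qed

text \<open>If the quotients converge to \<open>L \<ge> 0\<close>, the integral of
  \<open>L + f\<close> is at most that of \<open>f\<close>, so \<open>L\<close> vanishes almost
  everywhere.\<close>

lemma AE_not_quotients_pos:
  assumes nonneg: "AE z in N. 0 \<le> f z"
    and L: "AE z in N. \<exists>L. (\<lambda>m. g m z) \<longlonglongrightarrow> L \<and> 0 \<le> L \<and> (P z \<longrightarrow> 0 < L)"
  shows "AE z in N. \<not> P z"
proof -
  have [measurable]: "g m \<in> borel_measurable N" "f \<in> borel_measurable N" for m
    using g f by auto
  let ?h = "\<lambda>z. liminf (\<lambda>m. ennreal (g m z + f z))"
  have lim: "AE z in N. \<exists>L. ?h z = ennreal (L + f z) \<and> 0 \<le> L \<and> 0 \<le> f z \<and> (P z \<longrightarrow> 0 < L)"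
    using L nonneg
  proof eventually_elim
    case (elim z)
    then obtain L where L: "(\<lambda>m. g m z) \<longlonglongrightarrow> L" "0 \<le> L" "P z \<longrightarrow> 0 < L" by auto
    have "(\<lambda>m. ennreal (g m z + f z)) \<longlonglongrightarrow> ennreal (L + f z)"
      by (intro tendsto_intros L)
    then have "?h z = ennreal (L + f z)" by (rule lim_imp_Liminf[rotated]) simp
    with L elim show ?case by (intro exI[of _ L]) auto
  qed
  have f': "(\<integral>\<^sup>+z. ennreal (f z) \<partial>N) = ennreal (LINT z|N. f z)"
    by (rule nn_integral_eq_integral[OF f nonneg])
  have "AE z in N. ennreal (f z) \<le> ?h z"
    using lim by eventually_elim (auto intro!: ennreal_leI)
  moreover have "AE z in N. ?h z \<noteq> \<infinity>"
    using lim by eventually_elim (auto simp del: ennreal_plus)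
  \<comment> \<open>Subtracting in \<open>ennreal\<close> is faithful here, because \<open>f\<close>
    has a finite integral and lies below the liminf. The difference is the integral of the
    limit.\<close>
  moreover have "(\<integral>\<^sup>+z. ?h z - ennreal (f z) \<partial>N) = (\<integral>\<^sup>+z. ?h z \<partial>N) - (\<integral>\<^sup>+z. ennreal (f z) \<partial>N)"
    by (rule nn_integral_diff) (use calculation f' in \<open>auto\<close>)
  then have "(\<integral>\<^sup>+z. ?h z - ennreal (f z) \<partial>N) = 0"
    using ennreal_minus_mono[OF nn_integral_liminf_quotients order_refl, of "ennreal (LINT z|N. f z)"] f'
    by simp
  then have "AE z in N. ?h z - ennreal (f z) = 0"
    by (subst (asm) nn_integral_0_iff_AE) auto
  with lim show ?thesis
  proof eventually_elim
    case (elim z)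
    then obtain L where L: "?h z = ennreal (L + f z)" "0 \<le> L" "0 \<le> f z" "P z \<longrightarrow> 0 < L" by auto
    then have "ennreal L = 0" using elim(2) by (simp add: ennreal_minus)
    with L show ?case by (auto simp: ennreal_eq_0_iff)
  qed
qed

end

section \<open>The symmetric game\<close>

locale symmetric_game = usual_filtered_prob_space M F T
  for M :: "'a measure" and F T +
  fixes \<psi>x \<psi>c r :: "'a process" and n :: nat and b :: real and u :: "real \<times> real \<Rightarrow> real"
  assumes n: "1 < n" and b: "0 < b"
    and prices: "assumption_P M F T \<psi>x \<psi>c r"
    and utilities: "assumption_U M F T \<psi>x \<psi>c r n (\<lambda>i. b) (\<lambda>i. u)"
begin

abbreviation Q :: "('a \<times> real) measure" where "Q \<equiv> M \<Otimes>\<^sub>M dt T"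
abbreviation budget :: "('a process \<times> 'a process) set" where "budget \<equiv> budget_set M F T \<psi>x \<psi>c b"
abbreviation cost_x :: "'a process \<Rightarrow> ennreal" where "cost_x \<equiv> consumption_cost M T \<psi>x"
abbreviation cost_c :: "'a process \<Rightarrow> ennreal" where "cost_c \<equiv> contribution_cost M T \<psi>c"

text \<open>One agent plays \<open>(y, D)\<close>, each of the \<open>n - 1\<close> others contributes \<open>E\<close>.\<close>

definition flow :: "'a process \<Rightarrow> 'a process \<Rightarrow> 'a process \<Rightarrow> 'a \<times> real \<Rightarrow> real" where
  "flow y D E z = discount r (snd z) (fst z) * u (joint y z, joint D z + (real n - 1) * joint E z)"

text \<open>Per agent, and tested only against symmetric plans: with weights \<open>1/n\<close> the
  welfare of such a plan is the payoff of one agent.\<close>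

definition planner_optimal :: "'a process \<Rightarrow> 'a process \<Rightarrow> bool" where
  "planner_optimal X A \<longleftrightarrow> (X, A) \<in> budget \<and>
     (\<forall>(y, D)\<in>budget. (LINT z|Q. flow y D D z) \<le> (LINT z|Q. flow X A A z))"

text \<open>One agent deviates while the others keep contributing \<open>B\<close>; by symmetry this
  agent represents all of them.\<close>

definition nash_optimal :: "'a process \<Rightarrow> 'a process \<Rightarrow> bool" where
  "nash_optimal Y B \<longleftrightarrow> (Y, B) \<in> budget \<and>
     (\<forall>(y, D)\<in>budget. (LINT z|Q. flow y D B z) \<le> (LINT z|Q. flow Y B B z))"

section \<open>Budgets and utility flows of one agent\<close>

lemma price_facts:
  "price_process M F T \<psi>x" "price_process M F T \<psi>c" "T = \<infinity> \<longrightarrow> (AE \<omega> in M. \<psi>c T \<omega> = 0)"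
  using prices by (auto simp: assumption_P_def)

lemma utility: "regular_utility u"
  using utilities n by (auto simp: assumption_U_def)

lemma discount_pos: "0 < discount r s \<omega>"
  by (simp add: discount_def)

lemma budget_admissible: "(x, C) \<in> budget \<Longrightarrow> admissible M F T x C"
  by (simp add: budget_set_def)

lemma budget_optional:
  "(x, C) \<in> budget \<Longrightarrow> optional_process M F T x" "(x, C) \<in> budget \<Longrightarrow> optional_process M F T C"
  "(x, C) \<in> budget \<Longrightarrow> nonneg_process M T x" "(x, C) \<in> budget \<Longrightarrow> nonneg_process M T C"
  using budget_admissible[of x C] by (auto simp: admissible_def nonneg_process_def)

lemma budget_nonneg:
  "(x, C) \<in> budget \<Longrightarrow> z \<in> space Q \<Longrightarrow> 0 \<le> joint x z"
  "(x, C) \<in> budget \<Longrightarrow> z \<in> space Q \<Longrightarrow> 0 \<le> joint C z"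
  by (auto intro: joint_nonneg budget_optional)

lemma budget_costs:
  assumes "(x, C) \<in> budget"
  obtains p q where "cost_x x = ennreal p" "cost_c C = ennreal q" "0 \<le> p" "0 \<le> q" "p + q \<le> b"
proof -
  have le: "cost_x x + cost_c C \<le> ennreal b"
    using assms in_budget_set_iff[OF price_facts] by blast
  then have "cost_x x \<noteq> \<infinity>" "cost_c C \<noteq> \<infinity>" by (auto simp: top_unique)
  then obtain p q where pq: "cost_x x = ennreal p" "cost_c C = ennreal q" "0 \<le> p" "0 \<le> q"
    by (metis ennreal_cases infinity_ennreal_def)
  moreover have "p + q \<le> b" using le pq b by (simp flip: ennreal_plus)
  ultimately show ?thesis using that by blast
qed

lemma flow_nonneg:
  "(y, D) \<in> budget \<Longrightarrow> (x, E) \<in> budget \<Longrightarrow> z \<in> space Q \<Longrightarrow> 0 \<le> flow y D E z"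
  unfolding flow_def using n discount_pos[of "snd z" "fst z"]
  by (intro mult_nonneg_nonneg regular_utility_nonneg[OF utility] add_nonneg_nonneg budget_nonneg) auto

text \<open>The flow belongs to the uniformly integrable family through the tuple in which agent 1
  plays \<open>(y, D)\<close> and all others play \<open>(x, E)\<close>. Tolerance 1 in the
  definition already bounds its integral.\<close>

lemma flow_integrable:
  assumes yD: "(y, D) \<in> budget" and xE: "(x, E) \<in> budget"
  shows "integrable Q (flow y D E)"
proof -
  define \<F> where "\<F> = {(\<lambda>(\<omega>, s). discount r s \<omega> * u (x 1 (ereal s) \<omega>, \<Sum>j=1..n. C j (ereal s) \<omega>)) | x C.
           \<forall>j\<in>{1..n}. (x j, C j) \<in> budget}"
  have ui: "uniformly_integrable Q \<F>"
    using utilities n unfolding assumption_U_def \<F>_def by auto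
  define xx where "xx j = (if j = 1 then y else x)" for j :: nat
  define CC where "CC j = (if j = 1 then D else E)" for j :: nat
  have sum: "(\<Sum>j=1..n. CC j t \<omega>) = D t \<omega> + (real n - 1) * E t \<omega>" for t \<omega>
  proof -
    have "(\<Sum>j=1..n. CC j t \<omega>) = D t \<omega> + (\<Sum>j=Suc 1..n. CC j t \<omega>)"
      using n by (subst sum.atLeast_Suc_atMost) (auto simp: CC_def)
    also have "(\<Sum>j=Suc 1..n. CC j t \<omega>) = (\<Sum>j=Suc 1..n. E t \<omega>)"
      by (rule sum.cong) (auto simp: CC_def)
    also have "\<dots> = (real n - 1) * E t \<omega>" using n by (simp add: of_nat_diff)
    finally show ?thesis .
  qed
  have "flow y D E = (\<lambda>(\<omega>, s). discount r s \<omega> * u (xx 1 (ereal s) \<omega>, \<Sum>j=1..n. CC j (ereal s) \<omega>))"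
    unfolding sum by (auto simp: flow_def joint_def xx_def fun_eq_iff)
  then have "flow y D E \<in> \<F>"
    unfolding \<F>_def using yD xE by (intro CollectI exI[of _ xx] exI[of _ CC]) (auto simp: xx_def CC_def)
  then have fm [measurable]: "flow y D E \<in> borel_measurable Q"
    and "\<exists>g. integrable Q g \<and> (\<forall>z\<in>space Q. 0 \<le> g z) \<and>
      (\<integral>\<^sup>+z\<in>{z\<in>space Q. g z < \<bar>flow y D E z\<bar>}. ennreal \<bar>flow y D E z\<bar> \<partial>Q) \<le> ennreal 1"
    using ui[unfolded uniformly_integrable_def] zero_less_one by blast+
  then obtain g where g: "integrable Q g" "\<forall>z\<in>space Q. 0 \<le> g z"
    "(\<integral>\<^sup>+z\<in>{z\<in>space Q. g z < \<bar>flow y D E z\<bar>}. ennreal \<bar>flow y D E z\<bar> \<partial>Q) \<le> ennreal 1" by blast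
  have [measurable]: "g \<in> borel_measurable Q" using g(1) by auto
  \<comment> \<open>Where the flow exceeds the cut-off \<open>g\<close> the second summand counts it
    in full; elsewhere \<open>g\<close> dominates it.\<close>
  have "(\<integral>\<^sup>+z. ennreal (norm (flow y D E z)) \<partial>Q)
    \<le> (\<integral>\<^sup>+z. ennreal (g z) + ennreal \<bar>flow y D E z\<bar> * indicator {z\<in>space Q. g z < \<bar>flow y D E z\<bar>} z \<partial>Q)"
    by (rule nn_integral_mono) (auto simp: indicator_def ennreal_leI)
  also have "\<dots> = (\<integral>\<^sup>+z. ennreal (g z) \<partial>Q)
    + (\<integral>\<^sup>+z\<in>{z\<in>space Q. g z < \<bar>flow y D E z\<bar>}. ennreal \<bar>flow y D E z\<bar> \<partial>Q)"
    by (rule nn_integral_add) measurable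
  also have "\<dots> \<le> ennreal (LINT z|Q. g z) + ennreal 1"
    using g by (intro add_mono) (auto simp: nn_integral_eq_integral)
  also have "\<dots> < \<infinity>" by simp
  finally show ?thesis by (intro integrableI_bounded fm)
qed

lemma Q_not_null: "\<not> (AE z in Q. False)"
proof
  assume "AE z in Q. False"
  then have 0: "emeasure Q (space Q) = 0" by (subst (asm) AE_iff_measurable[OF sets.top]) auto
  obtain a where a: "0 < a" "ereal a \<le> T"
  proof (cases T)
    case (real a) then show ?thesis using that[of a] horizon_pos by simp
  next
    case PInf then show ?thesis using that[of 1] by simp
  qed (use horizon_pos in auto)
  have "{0..a} \<subseteq> {s. 0 \<le> s \<and> ereal s \<le> T}"
    using a(2) by (auto intro: order_trans[of _ "ereal a"])
  then have "emeasure lborel {0..a} \<le> emeasure lborel {s. 0 \<le> s \<and> ereal s \<le> T}"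
    by (intro emeasure_mono) auto
  also have "\<dots> = emeasure (dt T) (space (dt T))"
    unfolding space_dt unfolding dt_def by (subst emeasure_restrict_space) auto
  also have "\<dots> = emeasure Q (space Q)"
    unfolding space_pair_measure
    by (subst sigma_finite_measure.emeasure_pair_measure_Times[OF sigma_finite_dt]) (auto simp: emeasure_space_1)
  finally show False using 0 a by simp
qed

text \<open>The weight \<open>1/n\<close> is dictated by the public good: replacing one
  \<open>B\<close> by \<open>A\<close> moves the total \<open>n B\<close> exactly the fraction
  \<open>1/n\<close> of the way to \<open>n A\<close>. A jump at the horizon alone is not seen by
  this equality.\<close>

lemma contributions_coincide:
  assumes P: "planner_optimal X A" and N: "nash_optimal Y B" and le: "cost_c A \<le> cost_c B"
  shows "AE z in Q. joint X z = joint Y z \<and> joint A z = joint B z"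
proof -
  have XA: "(X, A) \<in> budget" and YB: "(Y, B) \<in> budget"
    using P N by (auto simp: planner_optimal_def nash_optimal_def)
  define q where "q = 1 / real n"
  have q: "0 < q" "q < 1" "q * real n = 1" using n by (auto simp: q_def)
  define y where "y = (\<lambda>t \<omega>. (1 - q) * Y t \<omega> + q * X t \<omega>)"
  \<comment> \<open>The factor 1 brings \<open>A\<close> into the form expected by
    \<open>budget_setI\<close>.\<close>
  have dev: "(y, \<lambda>t \<omega>. 1 * A t \<omega>) \<in> budget"
  proof (rule budget_setI[OF price_facts _ _ budget_admissible[OF XA]])
    show "optional_process M F T y"
      using budget_optional[OF XA] budget_optional[OF YB] unfolding optional_process_iff y_def by measurable
    show "nonneg_process M T y"
      using budget_optional[OF XA] budget_optional[OF YB] q by (auto simp: nonneg_process_def y_def)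
    have "cost_x y = ennreal (1 - q) * cost_x Y + ennreal q * cost_x X"
      unfolding y_def by (rule consumption_cost_linear) (use q price_facts budget_optional[OF XA] budget_optional[OF YB] in auto)
    moreover obtain p1 q1 where 1: "cost_x X = ennreal p1" "cost_c A = ennreal q1" "0 \<le> p1" "0 \<le> q1" "p1 + q1 \<le> b"
      by (rule budget_costs[OF XA])
    moreover obtain p2 q2 where 2: "cost_x Y = ennreal p2" "cost_c B = ennreal q2" "0 \<le> p2" "0 \<le> q2" "p2 + q2 \<le> b"
      by (rule budget_costs[OF YB])
    moreover have "(1 - q) * p2 + q * p1 + q1 \<le> b"
    proof -
      have "q1 \<le> q2" using le 1 2 by simp
      \<comment> \<open>Both \<open>p2 + q1\<close> and \<open>p1 + q1\<close> are within the
        budget, the first because \<open>A\<close> costs no more than \<open>B\<close>; the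
        deviation costs their weighted mean.\<close>
      then have "(1 - q) * (p2 + q1) + q * (p1 + q1) \<le> (1 - q) * b + q * b"
        using q 1 2 by (intro add_mono mult_left_mono) auto
      then show ?thesis by (simp add: algebra_simps)
    qed
    ultimately show "cost_x y + ennreal 1 * cost_c A \<le> ennreal b"
      using q by (simp add: ennreal_mult[symmetric] ennreal_plus[symmetric] del: ennreal_plus)
  qed simp
  define h where "h z = (1 - q) * flow Y B B z + q * flow X A A z" for z
  let ?f = "flow y (\<lambda>t \<omega>. 1 * A t \<omega>) B"
  have total: "joint A z + (real n - 1) * joint B z
      = (1 - q) * (joint B z + (real n - 1) * joint B z) + q * (joint A z + (real n - 1) * joint A z)" for z
  proof -
    have "(1 - q) * (joint B z + (real n - 1) * joint B z) + q * (joint A z + (real n - 1) * joint A z)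
      = real n * joint B z - (q * real n) * joint B z + (q * real n) * joint A z" by (simp add: algebra_simps)
    then show ?thesis by (simp add: q algebra_simps)
  qed
  have f_eq: "?f z = discount r (snd z) (fst z) * u ((1 - q) * joint Y z + q * joint X z,
      (1 - q) * (joint B z + (real n - 1) * joint B z) + q * (joint A z + (real n - 1) * joint A z))" for z
  proof -
    have "joint y z = (1 - q) * joint Y z + q * joint X z" by (simp add: y_def joint_def)
    then show ?thesis by (simp only: flow_def total[symmetric] mult_1)
  qed
  have "AE z in Q. h z = ?f z"
  proof (rule integral_le_imp_AE_eq)
    show "integrable Q h" unfolding h_def using flow_integrable[OF XA XA] flow_integrable[OF YB YB] by auto
    show "integrable Q ?f" by (rule flow_integrable[OF dev YB])
    show "AE z in Q. h z \<le> ?f z"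
    proof (rule AE_I2)
      fix z assume z: "z \<in> space Q"
      note nn = budget_nonneg[OF XA z] budget_nonneg[OF YB z]
      have "(1 - q) * u (joint Y z, joint B z + (real n - 1) * joint B z) + q * u (joint X z, joint A z + (real n - 1) * joint A z)
        \<le> u ((1 - q) * joint Y z + q * joint X z,
             (1 - q) * (joint B z + (real n - 1) * joint B z) + q * (joint A z + (real n - 1) * joint A z))"
        using nn n q by (intro regular_utility_concave[OF utility] add_nonneg_nonneg mult_nonneg_nonneg) auto
      from mult_left_mono[OF this less_imp_le[OF discount_pos[of "snd z" "fst z"]]]
      show "h z \<le> ?f z"
        unfolding f_eq unfolding h_def flow_def by (simp only: distrib_left mult.left_commute)
    qed
    have "(LINT z|Q. ?f z) \<le> (LINT z|Q. flow Y B B z)" using N dev by (auto simp: nash_optimal_def)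
    also have "\<dots> \<le> (1 - q) * (LINT z|Q. flow Y B B z) + q * (LINT z|Q. flow X A A z)"
    proof -
      \<comment> \<open>The equilibrium is itself a symmetric plan that the planner can
        afford.\<close>
      have "(LINT z|Q. flow Y B B z) \<le> (LINT z|Q. flow X A A z)"
        using P YB by (auto simp: planner_optimal_def)
      then have "q * (LINT z|Q. flow Y B B z) \<le> q * (LINT z|Q. flow X A A z)"
        using q by (intro mult_left_mono) auto
      then show ?thesis by (simp add: algebra_simps)
    qed
    also have "\<dots> = (LINT z|Q. h z)"
      unfolding h_def using flow_integrable[OF XA XA] flow_integrable[OF YB YB] by simp
    finally show "(LINT z|Q. ?f z) \<le> (LINT z|Q. h z)" .
  qed
  with AE_space show ?thesis
  proof eventually_elim
    case (elim z)
    note nn = budget_nonneg[OF XA elim(1)] budget_nonneg[OF YB elim(1)]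
    show ?case
    proof (rule ccontr)
      assume ne: "\<not> (joint X z = joint Y z \<and> joint A z = joint B z)"
      have "(1 - q) * u (joint Y z, joint B z + (real n - 1) * joint B z) + q * u (joint X z, joint A z + (real n - 1) * joint A z)
        < u ((1 - q) * joint Y z + q * joint X z,
             (1 - q) * (joint B z + (real n - 1) * joint B z) + q * (joint A z + (real n - 1) * joint A z))"
      proof (rule regular_utility_strictly_concave[OF utility])
        have "joint C z + (real n - 1) * joint C z = real n * joint C z" for C by (simp add: algebra_simps)
        then show "(joint Y z, joint B z + (real n - 1) * joint B z) \<noteq> (joint X z, joint A z + (real n - 1) * joint A z)"
          using ne n by auto
      qed (use nn n q in \<open>auto intro!: add_nonneg_nonneg mult_nonneg_nonneg\<close>)
      from mult_strict_left_mono[OF this discount_pos[of "snd z" "fst z"]]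
      have "h z < ?f z"
        unfolding f_eq unfolding h_def flow_def by (simp only: distrib_left mult.left_commute)
      with elim show False by simp
    qed
  qed
qed


text \<open>A contribution at the horizon alone buys no utility, so its cost is better spent on consumption.\<close>

lemma planner_contributes:
  assumes P: "planner_optimal X A" and c: "cost_c A \<noteq> 0"
  shows "\<not> (AE z in Q. joint A z = 0)"
proof
  assume A0: "AE z in Q. joint A z = 0"
  have XA: "(X, A) \<in> budget" using P by (auto simp: planner_optimal_def)
  obtain p q where pq: "cost_x X = ennreal p" "cost_c A = ennreal q" "0 \<le> p" "0 \<le> q" "p + q \<le> b"
    by (rule budget_costs[OF XA])
  have q: "0 < q" using c pq by (cases "q = 0") auto
  \<comment> \<open>Halving the contribution frees \<open>q / 2\<close>, which pays for
    \<open>decay (q / 2)\<close>. The public good stays 0 almost everywhere, so the change is a pure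
    gain in consumption.\<close>
  define y where "y = (\<lambda>t \<omega>. 1 * X t \<omega> + 1 * decay (q / 2) t \<omega>)"
  have decay: "optional_process M F T (decay (q / 2))" "nonneg_process M T (decay (q / 2))"
    using optional_exp_decay[of "q / 2"] q by (auto simp: decay_def nonneg_process_def)
  have dev: "(y, \<lambda>t \<omega>. 1/2 * A t \<omega>) \<in> budget" (is "(y, ?D) \<in> _")
  proof (rule budget_setI[OF price_facts _ _ budget_admissible[OF XA]])
    show "optional_process M F T y"
      using budget_optional[OF XA] decay unfolding optional_process_iff y_def by measurable
    show "nonneg_process M T y"
      using budget_optional[OF XA] decay by (auto simp: nonneg_process_def y_def)
    have "cost_x y = ennreal 1 * cost_x X + ennreal 1 * cost_x (decay (q / 2))"
      unfolding y_def by (rule consumption_cost_linear) (use price_facts budget_optional[OF XA] decay in auto)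
    also have "\<dots> \<le> ennreal p + ennreal (q / 2)"
      using consumption_cost_decay[OF price_facts(1), of "q / 2"] q pq by (simp add: add_left_mono)
    finally have "cost_x y + ennreal (1/2) * cost_c A \<le> ennreal p + ennreal (q / 2) + ennreal (1/2) * ennreal q"
      by (intro add_mono) (auto simp: pq)
    also have "ennreal (1/2) * ennreal q = ennreal (q / 2)"
      by (subst ennreal_mult[symmetric]) (use pq in auto)
    also have "ennreal p + ennreal (q / 2) + ennreal (q / 2) = ennreal (p + q)"
      using pq by (simp flip: ennreal_plus)
    also have "\<dots> \<le> ennreal b" using pq by (intro ennreal_leI)
    finally show "cost_x y + ennreal (1/2) * cost_c A \<le> ennreal b" .
  qed simp
  have less: "AE z in Q. flow X A A z < flow y ?D ?D z"
    using A0 AE_space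
  proof eventually_elim
    case (elim z)
    have "0 < joint (decay (q / 2)) z" using q by (simp add: joint_def decay_def)
    moreover have "joint y z = joint X z + joint (decay (q / 2)) z" by (simp add: joint_def y_def)
    ultimately have "joint X z < joint y z" by simp
    then have "u (joint X z, 0) < u (joint y z, 0)"
      using budget_nonneg[OF XA elim(2)] by (intro regular_utility_strict_mono[OF utility]) auto
    moreover have "joint ?D z = 0" using elim(1) by (simp add: joint_def)
    ultimately show ?case using elim(1) discount_pos by (simp add: flow_def)
  qed
  have "AE z in Q. flow X A A z = flow y ?D ?D z"
  proof (rule integral_le_imp_AE_eq)
    show "(LINT z|Q. flow y ?D ?D z) \<le> (LINT z|Q. flow X A A z)"
      using P dev by (auto simp: planner_optimal_def)
    show "AE z in Q. flow X A A z \<le> flow y ?D ?D z" using less by eventually_elim simp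
  qed (rule flow_integrable[OF XA XA] flow_integrable[OF dev dev])+
  with less have "AE z in Q. False" by eventually_elim simp
  with Q_not_null show False ..
qed

section \<open>Small deviations and their difference quotients\<close>

lemma total_flow:
  "flow y (\<lambda>t \<omega>. a * D t \<omega>) (\<lambda>t \<omega>. a * D t \<omega>) z = discount r (snd z) (fst z) * u (joint y z, a * (real n * joint D z))"
  "flow y D D z = discount r (snd z) (fst z) * u (joint y z, real n * joint D z)"
  by (simp_all add: flow_def joint_def algebra_simps)

text \<open>When \<open>t\<close> is proportional to the step of a deviation, dividing by the step
  gives an integrable lower bound for the quotient, uniform in the step.\<close>

lemma flow_shrink:
  assumes XA: "(X, A) \<in> budget" and z: "z \<in> space Q" and t: "0 \<le> t" "t \<le> 1"
    and y: "(1 - t) * joint X z \<le> joint y z"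
    and D: "(1 - t) * (real n * joint A z) \<le> joint D z + (real n - 1) * joint E z"
  shows "- (t * flow X A A z) \<le> flow y D E z - flow X A A z"
proof -
  have "(1 - t) * u (joint X z, real n * joint A z) \<le> u (joint y z, joint D z + (real n - 1) * joint E z)"
    using budget_nonneg[OF XA z] t y D by (intro regular_utility_shrink[OF utility]) auto
  from mult_left_mono[OF this less_imp_le[OF discount_pos[of "snd z" "fst z"]]]
  have "(1 - t) * flow X A A z \<le> flow y D E z"
    unfolding total_flow unfolding flow_def by (simp only: mult.left_commute)
  then show ?thesis by (simp add: algebra_simps)
qed

text \<open>Otherwise the planner could scale \<open>A\<close> down by \<open>1 - e\<close> and
  spend the savings on consumption where there is none; by \<open>regular_utility_Inada\<close> the
  gain per unit of \<open>e\<close> would be unbounded there.\<close>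

lemma planner_consumes:
  assumes P: "planner_optimal X A" and c: "cost_c A \<noteq> 0"
  shows "AE z in Q. 0 < joint A z \<longrightarrow> 0 < joint X z"
proof -
  have XA: "(X, A) \<in> budget" using P by (auto simp: planner_optimal_def)
  obtain p q where pq: "cost_x X = ennreal p" "cost_c A = ennreal q" "0 \<le> p" "0 \<le> q" "p + q \<le> b"
    by (rule budget_costs[OF XA])
  have q: "0 < q" using c pq by (cases "q = 0") auto
  \<comment> \<open>The extra consumption sits only on the set to be shown null. It costs at most
    \<open>q\<close>, so \<open>e m * I\<close> is covered by what scaling \<open>A\<close> by
    \<open>1 - e m\<close> saves.\<close>
  define I where "I = (\<lambda>t \<omega>. if X t \<omega> = 0 \<and> 0 < A t \<omega> then decay q t \<omega> else 0)"
  have decay: "optional_process M F T (decay q)" "nonneg_process M T (decay q)"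
    using optional_exp_decay[of q] q by (auto simp: decay_def nonneg_process_def)
  have I: "optional_process M F T I" "nonneg_process M T I"
  proof -
    have [measurable]: "(\<lambda>z. X (snd z) (fst z)) \<in> borel_measurable (optional_algebra M F T)"
      "(\<lambda>z. A (snd z) (fst z)) \<in> borel_measurable (optional_algebra M F T)"
      "(\<lambda>z. decay q (snd z) (fst z)) \<in> borel_measurable (optional_algebra M F T)"
      using budget_optional[OF XA] decay by (simp_all add: optional_process_iff)
    show "optional_process M F T I" unfolding optional_process_iff I_def by measurable
    show "nonneg_process M T I" using decay by (auto simp: nonneg_process_def I_def)
  qed
  have cost_I: "cost_x I \<le> ennreal q"
  proof -
    have "cost_x I \<le> cost_x (decay q)"
      using joint_nonneg[OF decay(2)]
      by (intro consumption_cost_mono price_facts) (auto simp: I_def joint_def)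
    also have "\<dots> \<le> ennreal q" using q by (intro consumption_cost_decay price_facts) simp
    finally show ?thesis .
  qed
  \<comment> \<open>The shift by 2 keeps \<open>e m\<close> strictly below 1.\<close>
  define e where "e m = 1 / real (m + 2)" for m :: nat
  have e: "0 < e m" "e m < 1" for m by (auto simp: e_def)
  have e_lim: "filterlim e (at_right 0) sequentially"
  proof -
    have "e \<longlonglongrightarrow> 0" unfolding e_def using LIMSEQ_ignore_initial_segment[OF lim_1_over_n, of 2] by simp
    then show ?thesis
      by (rule tendsto_imp_filterlim_at_right) (simp add: e(1))
  qed
  define y where "y m = (\<lambda>t \<omega>. 1 * X t \<omega> + e m * I t \<omega>)" for m
  define D where "D m = (\<lambda>t \<omega>. (1 - e m) * A t \<omega>)" for m
  have y: "joint (y m) z = joint X z + e m * joint I z" for m z by (simp add: joint_def y_def)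
  have D: "joint (D m) z = (1 - e m) * joint A z" for m z by (simp add: joint_def D_def)
  have dev: "(y m, D m) \<in> budget" for m
    unfolding D_def
  proof (rule budget_setI[OF price_facts _ _ budget_admissible[OF XA]])
    show "optional_process M F T (y m)"
      using budget_optional[OF XA] I unfolding optional_process_iff y_def by measurable
    show "nonneg_process M T (y m)"
      using budget_optional[OF XA] I e[of m] by (auto simp: nonneg_process_def y_def)
    have "cost_x (y m) = ennreal 1 * cost_x X + ennreal (e m) * cost_x I"
      unfolding y_def using e[of m] by (intro consumption_cost_linear price_facts budget_optional[OF XA] I) auto
    also have "\<dots> \<le> ennreal p + ennreal (e m) * ennreal q"
      using cost_I pq by (auto intro!: add_left_mono mult_left_mono)
    finally have "cost_x (y m) + ennreal (1 - e m) * cost_c A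
        \<le> ennreal p + ennreal (e m) * ennreal q + ennreal (1 - e m) * ennreal q"
      by (intro add_mono) (auto simp: pq)
    also have "\<dots> = ennreal (p + e m * q + (1 - e m) * q)"
      using pq e[of m] by (simp add: ennreal_mult ennreal_plus)
    also have "\<dots> \<le> ennreal b" using pq by (intro ennreal_leI) (simp add: algebra_simps)
    finally show "cost_x (y m) + ennreal (1 - e m) * cost_c A \<le> ennreal b" .
  qed (use e[of m] in simp)
  define g where "g m z = (flow (y m) (D m) (D m) z - flow X A A z) / e m" for m z
  note int = flow_integrable[OF dev dev] flow_integrable[OF XA XA]
  have "AE z in Q. \<not> (joint X z = 0 \<and> 0 < joint A z)"
  proof (rule AE_not_quotients_at_top[where g=g and f="flow X A A"])
    show "integrable Q (g m)" for m unfolding g_def using int by auto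
    show "(LINT z|Q. g m z) \<le> 0" for m
    proof -
      have "(LINT z|Q. flow (y m) (D m) (D m) z) \<le> (LINT z|Q. flow X A A z)"
        using P dev by (auto simp: planner_optimal_def)
      then show ?thesis unfolding g_def using int e[of m] by (simp add: divide_le_0_iff)
    qed
    show "AE z in Q. - flow X A A z \<le> g m z" for m
    proof (rule AE_I2)
      fix z assume z: "z \<in> space Q"
      note nn = budget_nonneg[OF XA z]
      have "- (e m * flow X A A z) \<le> flow (y m) (D m) (D m) z - flow X A A z"
      proof (rule flow_shrink[OF XA z])
        show "(1 - e m) * joint X z \<le> joint (y m) z"
          using nn e[of m] joint_nonneg[OF I(2) z] by (simp add: y algebra_simps add_nonneg_nonneg)
        show "(1 - e m) * (real n * joint A z) \<le> joint (D m) z + (real n - 1) * joint (D m) z"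
          by (simp add: D algebra_simps)
      qed (use e[of m] in auto)
      then show "- flow X A A z \<le> g m z" using e[of m] by (simp add: g_def field_simps)
    qed
    show "AE z in Q. joint X z = 0 \<and> 0 < joint A z \<longrightarrow> filterlim (\<lambda>m. g m z) at_top sequentially"
    proof (rule AE_I2, rule impI)
      fix z assume z: "z \<in> space Q" and XA0: "joint X z = 0 \<and> 0 < joint A z"
      define k where "k = joint I z"
      have k: "0 < k" using XA0 q by (auto simp: k_def I_def joint_def decay_def)
      define \<delta> where "\<delta> = discount r (snd z) (fst z)"
      define c where "c = real n * joint A z"
      have c: "0 < c" using XA0 n by (simp add: c_def)
      have "filterlim (\<lambda>m. (u (e m * k, (1 - e m) * c) - u (0, c)) / e m) at_top sequentially"
        by (rule filterlim_compose[OF regular_utility_Inada[OF utility c k] e_lim])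
      then have "filterlim (\<lambda>m. \<delta> * ((u (e m * k, (1 - e m) * c) - u (0, c)) / e m)) at_top sequentially"
        by (intro filterlim_tendsto_pos_mult_at_top[OF tendsto_const]) (simp_all add: \<delta>_def discount_pos)
      moreover have "g m z = \<delta> * ((u (e m * k, (1 - e m) * c) - u (0, c)) / e m)" for m
        unfolding g_def D_def total_flow using XA0
        by (simp add: y k_def c_def \<delta>_def right_diff_distrib)
      ultimately show "filterlim (\<lambda>m. g m z) at_top sequentially" by simp
    qed
  qed (rule int)
  with AE_space show ?thesis
    by eventually_elim (use budget_nonneg[OF XA] in force)
qed

lemma planner_spends_more:
  assumes P: "planner_optimal X A" and N: "nash_optimal Y B" and c: "cost_c A \<noteq> 0"
  shows "cost_c B < cost_c A"
proof (rule ccontr)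
  assume "\<not> cost_c B < cost_c A"
  then have le: "cost_c A \<le> cost_c B" by simp
  have XA: "(X, A) \<in> budget" and YB: "(Y, B) \<in> budget"
    using P N by (auto simp: planner_optimal_def nash_optimal_def)
  note eq = contributions_coincide[OF P N le]
  obtain p q where pq: "cost_x X = ennreal p" "cost_c A = ennreal q" "0 \<le> p" "0 \<le> q" "p + q \<le> b"
    by (rule budget_costs[OF XA])
  obtain p' q' where pq': "cost_x Y = ennreal p'" "cost_c B = ennreal q'" "0 \<le> p'" "0 \<le> q'" "p' + q' \<le> b"
    by (rule budget_costs[OF YB])
  have "0 < q" using c pq by (cases "q = 0") auto
  \<comment> \<open>Only an inequality is available, since equality \<open>dt\<close>-almost
    everywhere ignores a jump at the horizon.\<close>
  moreover have "q \<le> q'" using le unfolding pq pq' using ennreal_le_iff[OF pq'(4)] by blast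
  ultimately have q: "0 < q" "q \<le> q'" .
  \<comment> \<open>Where the contribution is 0, scaling it changes nothing and \<open>u\<close>
    need not be differentiable. Consumption is therefore adjusted only on the part
    \<open>on\<close>.\<close>
  define on :: "'a process \<Rightarrow> 'a process \<Rightarrow> 'a process"
    where "on x C = (\<lambda>t \<omega>. if 0 < C t \<omega> then x t \<omega> else 0)" for x C
  define off :: "'a process \<Rightarrow> 'a process \<Rightarrow> 'a process"
    where "off x C = (\<lambda>t \<omega>. if 0 < C t \<omega> then 0 else x t \<omega>)" for x C
  have part: "optional_process M F T (on x C)" "nonneg_process M T (on x C)"
    "optional_process M F T (off x C)" "nonneg_process M T (off x C)" if xC: "(x, C) \<in> budget" for x C
  proof -
    have [measurable]: "(\<lambda>z. x (snd z) (fst z)) \<in> borel_measurable (optional_algebra M F T)"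
      "(\<lambda>z. C (snd z) (fst z)) \<in> borel_measurable (optional_algebra M F T)"
      using budget_optional[OF xC] by (simp_all add: optional_process_iff)
    show "optional_process M F T (on x C)" "optional_process M F T (off x C)"
      unfolding optional_process_iff on_def off_def by measurable
    show "nonneg_process M T (on x C)" "nonneg_process M T (off x C)"
      using budget_optional[OF xC] by (auto simp: nonneg_process_def on_def off_def)
  qed
  have joint_on: "joint (on x C) z = (if 0 < joint C z then joint x z else 0)"
    and joint_off: "joint (off x C) z = (if 0 < joint C z then 0 else joint x z)" for x C z
    by (auto simp: joint_def on_def off_def)
  \<comment> \<open>This common cost lets one rate \<open>\<kappa>\<close> balance the planner's and
    the agent's moves.\<close>
  have on_eq: "cost_x (on Y B) = cost_x (on X A)"
    unfolding consumption_cost_def by (rule nn_integral_cong_AE) (use eq in \<open>eventually_elim, simp add: joint_on\<close>)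
  have split: "cost_x X = cost_x (off X A) + cost_x (on X A)"
  proof -
    have "X = (\<lambda>t \<omega>. 1 * off X A t \<omega> + 1 * on X A t \<omega>)" by (auto simp: on_def off_def fun_eq_iff)
    then have "cost_x X = cost_x (\<lambda>t \<omega>. 1 * off X A t \<omega> + 1 * on X A t \<omega>)" by simp
    also have "\<dots> = ennreal 1 * cost_x (off X A) + ennreal 1 * cost_x (on X A)"
      by (intro consumption_cost_linear price_facts part[OF XA]) auto
    finally show ?thesis by simp
  qed
  have "cost_x (off X A) \<noteq> \<infinity>" "cost_x (on X A) \<noteq> \<infinity>" using split pq by auto
  then obtain p0 a where pa: "cost_x (off X A) = ennreal p0" "cost_x (on X A) = ennreal a" "0 \<le> p0" "0 \<le> a"
    by (metis ennreal_cases infinity_ennreal_def)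
  have p: "p = p0 + a" using split pq pa by (simp flip: ennreal_plus)
  \<comment> \<open>If this part cost nothing, consumption would vanish wherever \<open>A\<close> is
    positive; by \<open>planner_consumes\<close> the contribution would then be 0 almost
    everywhere.\<close>
  have a: "0 < a"
  proof (rule ccontr)
    assume "\<not> 0 < a"
    then have "cost_x (on X A) = 0" using pa by simp
    moreover have "(\<lambda>z. ennreal (joint \<psi>x z * joint (on X A) z)) \<in> borel_measurable Q"
      using price_measurable[OF price_facts(1)] joint_measurable[OF part(1)[OF XA]] by measurable
    ultimately have "AE z in Q. ennreal (joint \<psi>x z * joint (on X A) z) = 0"
      unfolding consumption_cost_def by (subst (asm) nn_integral_0_iff_AE) auto
    then have "AE z in Q. joint A z = 0"
      using planner_consumes[OF P c] AE_space
    proof eventually_elim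
      case (elim z)
      then show ?case
        using price_pos[OF price_facts(1) elim(3)] budget_nonneg[OF XA elim(3)]
        by (cases "joint A z = 0") (auto simp: joint_on ennreal_eq_0_iff mult_le_0_iff)
    qed
    with planner_contributes[OF P c] show False ..
  qed
  \<comment> \<open>The exchange rate: giving up the fraction \<open>\<kappa> * e\<close> of the
    consumption on \<open>on\<close>, of cost \<open>a\<close>, frees \<open>e * q\<close>, exactly
    the price of raising \<open>A\<close> by the fraction \<open>e\<close>.\<close>
  define \<kappa> where "\<kappa> = q / a"
  have \<kappa>: "0 < \<kappa>" "\<kappa> * a = q" using q a by (auto simp: \<kappa>_def)
  \<comment> \<open>The factor \<open>\<kappa> + 1\<close> keeps both \<open>e m\<close> and
    \<open>\<kappa> * e m\<close> below 1, so that the scaled processes stay nonnegative.\<close>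
  define e where "e m = 1 / (real (m + 2) * (\<kappa> + 1))" for m :: nat
  have e: "0 < e m" "e m < 1" "\<kappa> * e m < 1" for m
  proof -
    show "0 < e m" using \<kappa> by (simp add: e_def)
    have "1 * (\<kappa> + 1) < real (m + 2) * (\<kappa> + 1)" using \<kappa> by (intro mult_strict_right_mono) auto
    then have "e m * (\<kappa> + 1) < 1" using \<kappa> by (simp add: e_def divide_simps)
    then have "e m + \<kappa> * e m < 1" by (simp add: algebra_simps)
    then show "e m < 1" "\<kappa> * e m < 1"
      using \<open>0 < e m\<close> mult_pos_pos[OF \<kappa>(1) \<open>0 < e m\<close>] by linarith+
  qed
  have e_lim: "filterlim e (at_right 0) sequentially"
  proof -
    have "(\<lambda>m. 1 / (\<kappa> + 1) * (1 / real (m + 2))) \<longlonglongrightarrow> 1 / (\<kappa> + 1) * 0"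
      using LIMSEQ_ignore_initial_segment[OF lim_1_over_n, of 2] by (intro tendsto_mult_left) simp
    then have "e \<longlonglongrightarrow> 0" by (simp add: e_def[abs_def] mult.commute)
    then show ?thesis
      by (rule tendsto_imp_filterlim_at_right) (simp add: e(1))
  qed
  define y1 where "y1 m = (\<lambda>t \<omega>. 1 * off X A t \<omega> + (1 - \<kappa> * e m) * on X A t \<omega>)" for m
  define D1 where "D1 m = (\<lambda>t \<omega>. (1 + e m) * A t \<omega>)" for m
  define y2 where "y2 m = (\<lambda>t \<omega>. 1 * Y t \<omega> + (\<kappa> * e m) * on Y B t \<omega>)" for m
  define D2 where "D2 m = (\<lambda>t \<omega>. (1 - e m) * B t \<omega>)" for m
  have dev1: "(y1 m, D1 m) \<in> budget" for m
    unfolding D1_def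
  proof (rule budget_setI[OF price_facts _ _ budget_admissible[OF XA]])
    show "optional_process M F T (y1 m)"
      using part[OF XA] unfolding optional_process_iff y1_def by measurable
    show "nonneg_process M T (y1 m)"
      using part[OF XA] e[of m] by (auto simp: nonneg_process_def y1_def)
    have "cost_x (y1 m) = ennreal 1 * cost_x (off X A) + ennreal (1 - \<kappa> * e m) * cost_x (on X A)"
      unfolding y1_def using e[of m] by (intro consumption_cost_linear price_facts part[OF XA]) auto
    then have "cost_x (y1 m) + ennreal (1 + e m) * cost_c A = ennreal (p0 + (1 - \<kappa> * e m) * a + (1 + e m) * q)"
      using pq pa e[of m] by (simp add: ennreal_mult ennreal_plus)
    also have "p0 + (1 - \<kappa> * e m) * a + (1 + e m) * q = p + q"
    proof -
      have "p0 + (1 - \<kappa> * e m) * a + (1 + e m) * q = p0 + a - e m * (\<kappa> * a) + q + e m * q"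
        by (simp add: algebra_simps)
      then show ?thesis by (simp add: \<kappa> p)
    qed
    also have "ennreal (p + q) \<le> ennreal b" using pq by (intro ennreal_leI)
    finally show "cost_x (y1 m) + ennreal (1 + e m) * cost_c A \<le> ennreal b" .
  qed (use e[of m] in simp)
  have dev2: "(y2 m, D2 m) \<in> budget" for m
    unfolding D2_def
  proof (rule budget_setI[OF price_facts _ _ budget_admissible[OF YB]])
    show "optional_process M F T (y2 m)"
      using part[OF YB] budget_optional[OF YB] unfolding optional_process_iff y2_def by measurable
    show "nonneg_process M T (y2 m)"
      using part[OF YB] budget_optional[OF YB] e[of m] \<kappa> by (auto simp: nonneg_process_def y2_def)
    have "cost_x (y2 m) = ennreal 1 * cost_x Y + ennreal (\<kappa> * e m) * cost_x (on Y B)"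
      unfolding y2_def using e[of m] \<kappa>
      by (intro consumption_cost_linear price_facts part[OF YB] budget_optional[OF YB]) auto
    then have "cost_x (y2 m) + ennreal (1 - e m) * cost_c B = ennreal (p' + (\<kappa> * e m) * a + (1 - e m) * q')"
      using pq' pa e[of m] \<kappa> by (simp add: on_eq ennreal_mult ennreal_plus)
    also have "\<dots> \<le> ennreal b"
    proof (rule ennreal_leI)
      \<comment> \<open>The agent saves \<open>e m * q'\<close> and spends \<open>e m * q\<close>,
        so \<open>q \<le> q'\<close> suffices.\<close>
      have "p' + (\<kappa> * e m) * a + (1 - e m) * q' = p' + q' + e m * (\<kappa> * a - q')"
        by (simp add: algebra_simps)
      also have "\<dots> \<le> p' + q'" using q e[of m] by (simp add: \<kappa> mult_nonneg_nonpos)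
      finally show "p' + (\<kappa> * e m) * a + (1 - e m) * q' \<le> b" using pq' by simp
    qed
    finally show "cost_x (y2 m) + ennreal (1 - e m) * cost_c B \<le> ennreal b" .
  qed (use e[of m] in simp)
  \<comment> \<open>The two quotients are added before the limit: separately their limits contain
    the marginal utility of consumption with opposite signs.\<close>
  define g where "g m z = (flow (y1 m) (D1 m) (D1 m) z - flow X A A z + (flow (y2 m) (D2 m) B z - flow Y B B z)) / e m" for m z
  note int = flow_integrable[OF dev1 dev1] flow_integrable[OF dev2 YB] flow_integrable[OF XA XA] flow_integrable[OF YB YB]
  have "AE z in Q. \<not> 0 < joint A z"
  \<comment> \<open>The lower bound collects \<open>\<kappa>\<close> from the planner's move, which
    shrinks consumption by \<open>\<kappa> * e\<close>, and 1 from the agent's, which shrinks the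
    contribution by \<open>e\<close>.\<close>
  proof (rule AE_not_quotients_pos[where g=g and f="\<lambda>z. (\<kappa> + 1) * flow X A A z"])
    show "integrable Q (g m)" for m unfolding g_def using int by auto
    show "integrable Q (\<lambda>z. (\<kappa> + 1) * flow X A A z)" using int by auto
    show "(LINT z|Q. g m z) \<le> 0" for m
    proof -
      have "(LINT z|Q. flow (y1 m) (D1 m) (D1 m) z) \<le> (LINT z|Q. flow X A A z)"
        using P dev1 by (auto simp: planner_optimal_def)
      moreover have "(LINT z|Q. flow (y2 m) (D2 m) B z) \<le> (LINT z|Q. flow Y B B z)"
        using N dev2 by (auto simp: nash_optimal_def)
      ultimately show ?thesis unfolding g_def using int e[of m] by (simp add: divide_le_0_iff)
    qed
    show "AE z in Q. 0 \<le> (\<kappa> + 1) * flow X A A z"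
      using \<kappa> flow_nonneg[OF XA XA] by (intro AE_I2 mult_nonneg_nonneg) auto
    show "AE z in Q. - ((\<kappa> + 1) * flow X A A z) \<le> g m z" for m
      using eq AE_space
    proof eventually_elim
      case (elim z)
      note nn = budget_nonneg[OF XA elim(2)] budget_nonneg[OF YB elim(2)]
      have "- (\<kappa> * e m * flow X A A z) \<le> flow (y1 m) (D1 m) (D1 m) z - flow X A A z"
      proof (rule flow_shrink[OF XA elim(2)])
        have "joint (y1 m) z = joint (off X A) z + (1 - \<kappa> * e m) * joint (on X A) z" by (simp add: joint_def y1_def)
        then show "(1 - \<kappa> * e m) * joint X z \<le> joint (y1 m) z"
          using nn e[of m] \<kappa> by (auto simp: joint_on joint_off intro!: mult_left_le_one_le)
        have "(1 - \<kappa> * e m) * (real n * joint A z) \<le> (1 + e m) * (real n * joint A z)"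
        proof (rule mult_right_mono)
          show "1 - \<kappa> * e m \<le> 1 + e m" using e[of m] mult_pos_pos[OF \<kappa>(1) e(1)[of m]] by linarith
        qed (use nn in simp)
        also have "\<dots> = joint (D1 m) z + (real n - 1) * joint (D1 m) z" by (simp add: D1_def joint_def algebra_simps)
        finally show "(1 - \<kappa> * e m) * (real n * joint A z) \<le> joint (D1 m) z + (real n - 1) * joint (D1 m) z" .
      qed (use e[of m] \<kappa> in auto)
      moreover have "- (e m * flow Y B B z) \<le> flow (y2 m) (D2 m) B z - flow Y B B z"
      proof (rule flow_shrink[OF YB elim(2)])
        have y2: "joint (y2 m) z = joint Y z + (\<kappa> * e m) * joint (on Y B) z" by (simp add: joint_def y2_def)
        have "(1 - e m) * joint Y z \<le> joint Y z" using nn e[of m] by (intro mult_left_le_one_le) auto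
        also have "\<dots> \<le> joint (y2 m) z"
          using nn e[of m] \<kappa> by (simp add: y2 joint_on)
        finally show "(1 - e m) * joint Y z \<le> joint (y2 m) z" .
        have "joint (D2 m) z + (real n - 1) * joint B z - (1 - e m) * (real n * joint B z) = e m * ((real n - 1) * joint B z)"
          by (simp add: D2_def joint_def algebra_simps)
        also have "\<dots> \<ge> 0" using nn e[of m] n by simp
        finally show "(1 - e m) * (real n * joint B z) \<le> joint (D2 m) z + (real n - 1) * joint B z" by simp
      qed (use e[of m] in auto)
      moreover have "flow Y B B z = flow X A A z" using elim(1) by (simp add: flow_def)
      ultimately have "- ((\<kappa> + 1) * flow X A A z) * e m
        \<le> flow (y1 m) (D1 m) (D1 m) z - flow X A A z + (flow (y2 m) (D2 m) B z - flow Y B B z)"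
        by (simp add: algebra_simps)
      then show ?case unfolding g_def using e[of m] by (simp add: pos_le_divide_eq)
    qed
    show "AE z in Q. \<exists>L. (\<lambda>m. g m z) \<longlonglongrightarrow> L \<and> 0 \<le> L \<and> (0 < joint A z \<longrightarrow> 0 < L)"
      using eq planner_consumes[OF P c] AE_space
    proof eventually_elim
      case (elim z)
      note nn = budget_nonneg[OF XA elim(3)]
      define \<delta> where "\<delta> = discount r (snd z) (fst z)"
      define x where "x = joint X z"
      define C where "C = real n * joint A z"
      show ?case
      proof (cases "0 < joint A z")
        case False
        then have "joint A z = 0" using nn by simp
        \<comment> \<open>Here \<open>B\<close> vanishes as well, so neither move changes
          anything.\<close>
        then have "g m z = 0" for m
          using elim(1) by (simp add: g_def flow_def y1_def y2_def D1_def D2_def joint_def on_def off_def)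
        then show ?thesis using False by (intro exI[of _ 0]) auto
      next
        case True
        have C: "0 < C" and x: "0 < x" using True elim n by (auto simp: C_def x_def)
        have "1 / real n < 1" using n by simp
        from regular_utility_opposite_moves[OF utility x C this, of \<kappa>]
        obtain L where L: "0 < L"
          "((\<lambda>e. (u (x * (1 - \<kappa> * e), C * (1 + e)) + u (x * (1 + \<kappa> * e), C * (1 - 1 / real n * e)) - 2 * u (x, C)) / e)
             \<longlongrightarrow> L) (at_right 0)" by blast
        have f1: "flow (y1 m) (D1 m) (D1 m) z = \<delta> * u (x * (1 - \<kappa> * e m), C * (1 + e m))" for m
        proof -
          have "joint (y1 m) z = x * (1 - \<kappa> * e m)"
            using True by (simp add: y1_def joint_def on_def off_def x_def)
          then show ?thesis unfolding D1_def total_flow by (simp add: C_def \<delta>_def mult.commute)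
        qed
        have f2: "flow (y2 m) (D2 m) B z = \<delta> * u (x * (1 + \<kappa> * e m), C * (1 - 1 / real n * e m))" for m
        proof -
          have "joint (y2 m) z = joint Y z + (\<kappa> * e m) * joint (on Y B) z" by (simp add: joint_def y2_def)
          then have "joint (y2 m) z = x * (1 + \<kappa> * e m)"
            using True elim(1) by (simp add: joint_on x_def algebra_simps)
          \<comment> \<open>Only one of the \<open>n\<close> equal contributions is scaled, hence
            \<open>e / n\<close>; this gap to the planner's full \<open>e\<close> is what makes the
            limit positive.\<close>
          moreover have "joint (D2 m) z + (real n - 1) * joint B z = C * (1 - 1 / real n * e m)"
          proof -
            have "joint (D2 m) z = (1 - e m) * joint A z" using elim(1) by (simp add: D2_def joint_def)
            then have "joint (D2 m) z + (real n - 1) * joint B z = (1 - e m) * joint A z + (real n - 1) * joint A z"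
              using elim(1) by simp
            also have "\<dots> = C * (1 - 1 / real n * e m)" using n by (simp add: C_def field_simps)
            finally show ?thesis .
          qed
          ultimately show ?thesis by (simp add: flow_def \<delta>_def)
        qed
        have f0: "flow X A A z = \<delta> * u (x, C)" "flow Y B B z = \<delta> * u (x, C)"
          unfolding total_flow using elim(1) by (auto simp: x_def C_def \<delta>_def)
        have "(\<lambda>m. \<delta> * ((u (x * (1 - \<kappa> * e m), C * (1 + e m)) + u (x * (1 + \<kappa> * e m), C * (1 - 1 / real n * e m)) - 2 * u (x, C)) / e m))
          \<longlonglongrightarrow> \<delta> * L"
          by (intro tendsto_mult_left filterlim_compose[OF L(2) e_lim])
        moreover have "g m z = \<delta> * ((u (x * (1 - \<kappa> * e m), C * (1 + e m)) + u (x * (1 + \<kappa> * e m), C * (1 - 1 / real n * e m)) - 2 * u (x, C)) / e m)" for m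
          unfolding g_def f1 f2 f0 by (simp only: algebra_simps times_divide_eq_right mult_2)
        ultimately have "(\<lambda>m. g m z) \<longlonglongrightarrow> \<delta> * L" by simp
        moreover have "0 < \<delta> * L" using L(1) discount_pos by (simp add: \<delta>_def)
        ultimately show ?thesis by (intro exI[of _ "\<delta> * L"]) auto
      qed
    qed
  qed
  then have "AE z in Q. joint A z = 0"
    using AE_space by eventually_elim (use budget_nonneg[OF XA] in force)
  with planner_contributes[OF P c] show False ..
qed

end

section \<open>From the planner's problem and the game to one agent\<close>

lemma integral_enn2real:
  assumes f [measurable]: "f \<in> borel_measurable N" and fin: "(\<integral>\<^sup>+z. f z \<partial>N) \<noteq> \<infinity>"
  shows "integrable N (\<lambda>z. enn2real (f z))" "(LINT z|N. enn2real (f z)) = enn2real (\<integral>\<^sup>+z. f z \<partial>N)"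
proof -
  have "AE z in N. f z \<noteq> \<infinity>" by (rule nn_integral_PInf_AE[OF f fin])
  then have "AE z in N. ennreal (enn2real (f z)) = f z"
    by eventually_elim (simp add: less_top)
  then have eq: "(\<integral>\<^sup>+z. ennreal (enn2real (f z)) \<partial>N) = (\<integral>\<^sup>+z. f z \<partial>N)"
    by (rule nn_integral_cong_AE)
  show "integrable N (\<lambda>z. enn2real (f z))"
    using fin eq by (intro integrableI_bounded) (auto simp: less_top)
  show "(LINT z|N. enn2real (f z)) = enn2real (\<integral>\<^sup>+z. f z \<partial>N)"
    by (subst integral_eq_nn_integral) (auto simp: eq)
qed

lemma others_const:
  assumes "i \<in> {1..n}"
  shows "others n i (\<lambda>j. E) = (\<lambda>t \<omega>. (real n - 1) * E t \<omega>)"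
  using assms by (simp add: others_def card_Diff_singleton of_nat_diff)

context symmetric_game
begin

lemma payoff_eq:
  assumes yD: "(y, D) \<in> budget" and xE: "(x, E) \<in> budget"
  shows "payoff M T r u y D (\<lambda>t \<omega>. (real n - 1) * E t \<omega>) = ennreal (LINT z|Q. flow y D E z)"
proof -
  have m: "(\<lambda>z. ennreal (flow y D E z)) \<in> borel_measurable Q"
    using flow_integrable[OF assms] by (auto dest: borel_measurable_integrable)
  have "payoff M T r u y D (\<lambda>t \<omega>. (real n - 1) * E t \<omega>)
      = (\<integral>\<^sup>+\<omega>. \<integral>\<^sup>+s. ennreal (flow y D E (\<omega>, s)) \<partial>dt T \<partial>M)"
    by (simp add: payoff_def flow_def joint_def)
  also have "\<dots> = (\<integral>\<^sup>+z. ennreal (flow y D E z) \<partial>Q)" by (rule nn_integral_joint[OF m])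
  also have "\<dots> = ennreal (LINT z|Q. flow y D E z)"
    using flow_nonneg[OF assms] by (intro nn_integral_eq_integral flow_integrable[OF assms] AE_I2)
  finally show ?thesis .
qed

lemma planner_budget_iff:
  "((\<lambda>i. y), (\<lambda>i. D)) \<in> planner_budget_set M F T \<psi>x \<psi>c n (\<Sum>i=1..n. b) \<longleftrightarrow> (y, D) \<in> budget"
proof -
  have "(\<Sum>i=1..n. expenditure M T \<psi>x \<psi>c y D) \<le> ennreal (\<Sum>i=1..n. b)
    \<longleftrightarrow> of_nat n * expenditure M T \<psi>x \<psi>c y D \<le> of_nat n * ennreal b"
    using b by (simp add: ennreal_mult ennreal_of_nat_eq_real_of_nat)
  also have "\<dots> \<longleftrightarrow> expenditure M T \<psi>x \<psi>c y D \<le> ennreal b"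
    using n by (intro ennreal_mult_le_mult_iff) auto
  finally show ?thesis
    using n by (auto simp: planner_budget_set_def budget_set_def)
qed

lemma welfare_eq:
  assumes "(y, D) \<in> budget"
  shows "welfare M T r n (\<lambda>i. 1 / real n) (\<lambda>i. u) (\<lambda>i. y) (\<lambda>i. D) = ennreal (LINT z|Q. flow y D D z)"
proof -
  have "welfare M T r n (\<lambda>i. 1 / real n) (\<lambda>i. u) (\<lambda>i. y) (\<lambda>i. D)
    = (\<Sum>i=1..n. ennreal (1 / real n) * ennreal (LINT z|Q. flow y D D z))"
    unfolding welfare_def by (intro sum.cong refl) (simp only: others_const payoff_eq[OF assms assms])
  also have "\<dots> = ennreal (real n) * ennreal (1 / real n) * ennreal (LINT z|Q. flow y D D z)"
    by (simp add: ennreal_of_nat_eq_real_of_nat mult.assoc)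
  also have "ennreal (real n) * ennreal (1 / real n) = 1"
    using n by (subst ennreal_mult[symmetric]) auto
  finally show ?thesis by simp
qed

lemma integral_flow_nonneg:
  "(y, D) \<in> budget \<Longrightarrow> (x, E) \<in> budget \<Longrightarrow> 0 \<le> (LINT z|Q. flow y D E z)"
  using flow_nonneg by (intro integral_nonneg_AE AE_I2) auto

lemma planner_solution_optimal:
  assumes "planner_solution M F T \<psi>x \<psi>c r n (\<lambda>i. b) (\<lambda>i. u) (\<lambda>i. 1 / real n) (\<lambda>i. X) (\<lambda>i. A)"
  shows "planner_optimal X A"
  unfolding planner_optimal_def
proof safe
  show XA: "(X, A) \<in> budget" using assms unfolding planner_solution_def planner_budget_iff by blast
  fix y D assume yD: "(y, D) \<in> budget"
  have "welfare M T r n (\<lambda>i. 1 / real n) (\<lambda>i. u) (\<lambda>i. y) (\<lambda>i. D)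
    \<le> (SUP (y, D)\<in>planner_budget_set M F T \<psi>x \<psi>c n (\<Sum>i=1..n. b). welfare M T r n (\<lambda>i. 1 / real n) (\<lambda>i. u) y D)"
    using yD by (intro SUP_upper2[of "((\<lambda>i. y), (\<lambda>i. D))"]) (auto simp only: planner_budget_iff split_conv)
  also have "\<dots> = welfare M T r n (\<lambda>i. 1 / real n) (\<lambda>i. u) (\<lambda>i. X) (\<lambda>i. A)"
    using assms by (simp only: planner_solution_def)
  finally show "(LINT z|Q. flow y D D z) \<le> (LINT z|Q. flow X A A z)"
    by (simp only: welfare_eq yD XA ennreal_le_iff[OF integral_flow_nonneg[OF XA XA]])
qed

lemma nash_equilibrium_optimal:
  assumes N: "nash_equilibrium M F T \<psi>x \<psi>c r n (\<lambda>i. b) (\<lambda>i. u) (\<lambda>i. Y) (\<lambda>i. B)"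
  shows "nash_optimal Y B"
  unfolding nash_optimal_def
proof safe
  have 1: "1 \<in> {1..n}" using n by simp
  show YB: "(Y, B) \<in> budget" using N 1 unfolding nash_equilibrium_def by blast
  have "payoff M T r u Y B (others n 1 (\<lambda>i. B)) = best_value M F T \<psi>x \<psi>c r b u (others n 1 (\<lambda>i. B))"
    using N 1 unfolding nash_equilibrium_def by blast
  then have best: "best_value M F T \<psi>x \<psi>c r b u (\<lambda>t \<omega>. (real n - 1) * B t \<omega>) = ennreal (LINT z|Q. flow Y B B z)"
    by (simp only: others_const[OF 1] payoff_eq[OF YB YB])
  fix y D assume yD: "(y, D) \<in> budget"
  have "ennreal (LINT z|Q. flow y D B z) \<le> best_value M F T \<psi>x \<psi>c r b u (\<lambda>t \<omega>. (real n - 1) * B t \<omega>)"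
    unfolding best_value_def using yD
    by (intro SUP_upper2[of "(y, D)"]) (auto simp: payoff_eq[OF yD YB])
  then show "(LINT z|Q. flow y D B z) \<le> (LINT z|Q. flow Y B B z)"
    by (simp only: best ennreal_le_iff[OF integral_flow_nonneg[OF YB YB]])
qed

text \<open>The theorem speaks of total contributions, the argument of one agent's share;
  multiplying the share by \<open>n\<close> recovers the total. Finiteness will allow the two costs
  to be subtracted.\<close>

lemma contribution_cost_total:
  assumes "(\<lambda>t \<omega>. x t \<omega> / real n, \<lambda>t \<omega>. C t \<omega> / real n) \<in> budget"
  shows "cost_c C = ennreal (real n) * cost_c (\<lambda>t \<omega>. C t \<omega> / real n)" (is ?scale)
    and "cost_c C \<noteq> \<infinity>" (is ?fin)
    and "admissible M F T (\<lambda>t \<omega>. x t \<omega> / real n) C" (is ?adm)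
proof -
  have C: "(\<lambda>t \<omega>. real n * (C t \<omega> / real n)) = C" using n by simp
  note adm = budget_admissible[OF assms]
  show ?scale
    using contribution_cost_scale[OF price_facts(2,3) adm, of "real n"] unfolding C by simp
  moreover obtain q where "cost_c (\<lambda>t \<omega>. C t \<omega> / real n) = ennreal q"
    using budget_costs[OF assms] by blast
  ultimately show ?fin by (simp add: ennreal_mult_eq_top_iff)
  show ?adm
    using admissible_scale[OF budget_optional(1,3)[OF assms] adm, of "real n"] unfolding C by simp
qed

end

theorem proposition5p1:
  fixes M :: "'a measure" and F :: "ereal \<Rightarrow> 'a measure" and T :: ereal
    and \<psi>x \<psi>c r xs Cs xh Ch :: "ereal \<Rightarrow> 'a \<Rightarrow> real"
    and n :: nat and w :: real and u :: "real \<times> real \<Rightarrow> real"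
  assumes "usual_filtered_prob_space M F T"
    and "n > 1"
    and "w > 0"
    and "assumption_P M F T \<psi>x \<psi>c r"
    and "assumption_U M F T \<psi>x \<psi>c r n (\<lambda>i. w / real n) (\<lambda>i. u)"
    and "\<And>x c. x > 0 \<Longrightarrow> c > 0 \<Longrightarrow> partial_c (partial_x u) (x, c) \<ge> 0"
    and "planner_solution M F T \<psi>x \<psi>c r n (\<lambda>i. w / real n) (\<lambda>i. u) (\<lambda>i. 1 / real n)
           (\<lambda>i t \<omega>. xs t \<omega> / real n) (\<lambda>i t \<omega>. Cs t \<omega> / real n)"
    and "nash_equilibrium M F T \<psi>x \<psi>c r n (\<lambda>i. w / real n) (\<lambda>i. u)
           (\<lambda>i t \<omega>. xh t \<omega> / real n) (\<lambda>i t \<omega>. Ch t \<omega> / real n)"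
    and "(\<integral>\<^sup>+\<omega>. terminal_value T (\<lambda>t. Cs t \<omega>) \<partial>M) > 0"
  shows "(LINT \<omega>|M. enn2real (stieltjes_integral T (\<lambda>t. \<psi>c t \<omega>) (\<lambda>t. Cs t \<omega>))
                   - enn2real (stieltjes_integral T (\<lambda>t. \<psi>c t \<omega>) (\<lambda>t. Ch t \<omega>))) > 0"
proof -
  interpret symmetric_game M F T \<psi>x \<psi>c r n "w / real n" u
    using assms(1-5) by (intro symmetric_game.intro symmetric_game_axioms.intro) simp_all
  have P: "planner_optimal (\<lambda>t \<omega>. xs t \<omega> / real n) (\<lambda>t \<omega>. Cs t \<omega> / real n)"
    by (rule planner_solution_optimal[OF assms(7)])
  have N: "nash_optimal (\<lambda>t \<omega>. xh t \<omega> / real n) (\<lambda>t \<omega>. Ch t \<omega> / real n)"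
    by (rule nash_equilibrium_optimal[OF assms(8)])
  have "(\<lambda>t \<omega>. xs t \<omega> / real n, \<lambda>t \<omega>. Cs t \<omega> / real n) \<in> budget"
    "(\<lambda>t \<omega>. xh t \<omega> / real n, \<lambda>t \<omega>. Ch t \<omega> / real n) \<in> budget"
    using P N by (simp_all add: planner_optimal_def nash_optimal_def)
  note s = contribution_cost_total[OF this(1)] and h = contribution_cost_total[OF this(2)]
  \<comment> \<open>A zero cost of the share would give a zero cost of the total, and then no
    expected terminal contribution.\<close>
  have "cost_c (\<lambda>t \<omega>. Cs t \<omega> / real n) \<noteq> 0"
    using contribution_cost_eq_0[OF price_facts(2,3) s(3)] assms(9) s(1) by auto
  then have "cost_c (\<lambda>t \<omega>. Ch t \<omega> / real n) < cost_c (\<lambda>t \<omega>. Cs t \<omega> / real n)"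
    by (rule planner_spends_more[OF P N])
  then have "cost_c Ch < cost_c Cs"
    unfolding s(1) h(1) using n by (intro ennreal_mult_strict_left_mono) auto
  \<comment> \<open>Both costs are finite, so the pathwise integrals are almost surely finite:
    \<open>enn2real\<close> loses nothing and the integral of the difference splits.\<close>
  moreover have "(LINT \<omega>|M. enn2real (stieltjes_integral T (\<lambda>t. \<psi>c t \<omega>) (\<lambda>t. Cs t \<omega>))
      - enn2real (stieltjes_integral T (\<lambda>t. \<psi>c t \<omega>) (\<lambda>t. Ch t \<omega>))) = enn2real (cost_c Cs) - enn2real (cost_c Ch)"
    using s(2) h(2) unfolding contribution_cost_def
    by (subst Bochner_Integration.integral_diff)
       (auto intro!: integral_enn2real stieltjes_integral_measurable[OF price_facts(2,3)] s(3) h(3)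
         simp: integral_enn2real stieltjes_integral_measurable[OF price_facts(2,3) s(3)]
           stieltjes_integral_measurable[OF price_facts(2,3) h(3)])
  ultimately show ?thesis
    using s(2) by (simp add: enn2real_less_iff less_top)
qed

end
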